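(* Let $\mathbb G$ be the Engel group and let $\Psi:\mathbb R^4\to\mathbb G$ be the exponential coordinates of the second kind. There exists $L\ge0$ such that, for every horizontal vector $X$, there exists a basis $w_1,\ldots,w_4$ of $\mathbb R^4$ with the following property. If $E\subset\mathbb G$ is any subset that has constant horizontal normal $X$, then there exists an $L$-Lipschitz map $h:\mathbb R^3\to\mathbb R$ such that $E$ is equivalent to $$\{\Psi(a_1w_1+\ldots+a_4w_4)\;:\;a_1,a_2,a_3\in\mathbb R,\ a_4>h(a_1,a_2,a_3)\}.$$
   Context: The Engel algebra is the 4-dimensional real Lie algebra with basis $X_1,X_2,X_3,X_4$ and relations $[X_1,X_2]=X_3$, $[X_1,X_3]=X_4$, $[X_1,X_4]=[X_2,X_4]=[X_2,X_3]=[X_3,X_4]=0$. It is stratified by $V_1=\mathbb RX_1\oplus\mathbb RX_2$, $V_2=\mathbb RX_3$, $V_3=\mathbb RX_4$. The Engel group $\mathbb G$ is the unique connected and simply connected Lie group with this Lie algebra; elements of $\mathrm{Lie}(\mathbb G)$ are regarded as left-invariant vector fields, and the horizontal vectors are the elements of $V_1$. $\mathrm{vol}_{\mathbb G}$ is a Haar measure, and two sets $E,\tilde E$ are equivalent if $\mathrm{vol}_{\mathbb G}(E\Delta\tilde E)=0$. The exponential coordinates of the second kind are the diffeomorphism $\Psi(x_1,x_2,x_3,x_4)=\exp(x_4X_4)\exp(x_3X_3)\exp(x_2X_2)\exp(x_1X_1)$. For measurable $E\subset\mathbb G$ and $X\in\mathrm{Lie}(\mathbb G)$, write $X\mathbb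 1_E\ge0$ if $-\int_EX\phi\,d\mathrm{vol}_{\mathbb G}\ge0$ for all $\phi\in C_c^\infty(\mathbb G)$ with $\phi\ge0$, and $X\mathbb 1_E=0$ if $\int_EX\phi\,d\mathrm{vol}_{\mathbb G}=0$ for all such $\phi$. A scalar product $\langle\cdot|\cdot\rangle$ on $V_1$ is fixed. A (measurable) set $E\subseteq\mathbb G$ has constant horizontal normal $X$ if $X\in V_1$, $X\mathbb 1_E\ge0$, and $Y\mathbb 1_E=0$ for every $Y\in V_1$ with $\langle X|Y\rangle=0$.
   Formalization: The set E is additionally assumed to be equivalent neither to the empty set nor to all of the group; both of these have constant horizontal normal X but are never equivalent to a set of the stated form with h real-valued. *)

theory Defs
  imports "HOL-Analysis.Analysis"
begin

definition engel_X :: "4 \<Rightarrow> real^4" where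
  "engel_X i = axis i 1"

definition engel_bracket :: "real^4 \<Rightarrow> real^4 \<Rightarrow> real^4" where
  "engel_bracket x y =
     vector [0, 0, x$1 * y$2 - x$2 * y$1, x$1 * y$3 - x$3 * y$1]"

lemma vector_4:
  "(vector [a, b, c, d] :: real^4) $ 1 = a"
  "(vector [a, b, c, d] :: real^4) $ 2 = b"
  "(vector [a, b, c, d] :: real^4) $ 3 = c"
  "(vector [a, b, c, d] :: real^4) $ 4 = d"
  unfolding vector_def by simp_all

lemma engel_bracket_nth [simp]:
  "engel_bracket x y $ 1 = 0"
  "engel_bracket x y $ 2 = 0"
  "engel_bracket x y $ 3 = x$1 * y$2 - x$2 * y$1"
  "engel_bracket x y $ 4 = x$1 * y$3 - x$3 * y$1"
  by (simp_all add: engel_bracket_def vector_4)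

lemma engel_relations:
  "engel_bracket (engel_X 1) (engel_X 2) = engel_X 3"
  "engel_bracket (engel_X 1) (engel_X 3) = engel_X 4"
  "engel_bracket (engel_X 1) (engel_X 4) = 0"
  "engel_bracket (engel_X 2) (engel_X 4) = 0"
  "engel_bracket (engel_X 2) (engel_X 3) = 0"
  "engel_bracket (engel_X 3) (engel_X 4) = 0"
  by (simp_all add: vec_eq_iff forall_4 engel_X_def axis_def)

lemma engel_bracket_bilinear: "bilinear engel_bracket"
  by (auto simp: bilinear_def vec_eq_iff forall_4 algebra_simps intro!: linearI)

lemma engel_bracket_alternating: "engel_bracket x x = 0"
  by (simp add: vec_eq_iff forall_4)

lemma engel_bracket_jacobi:
  "engel_bracket x (engel_bracket y z) + engel_bracket y (engel_bracket z x)
     + engel_bracket z (engel_bracket x y) = 0"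
  by (simp add: vec_eq_iff forall_4 algebra_simps)

text \<open>
  The Engel group is modelled on the vector space of its Lie algebra, via exponential
  coordinates of the first kind: the product is the Baker--Campbell--Hausdorff series, which
  stops after the brackets of length three, and the exponential map is the identity map.
  The group is diffeomorphic to \<open>\<real>\<^sup>4\<close>, hence connected and simply connected. The
  lemmas below check that it is a group, that \<open>t \<mapsto> engel_exp (t *\<^sub>R X)\<close> are its one-parameter
  subgroups, and that its left-invariant vector fields have bracket \<open>engel_bracket\<close>.
\<close>

definition engel_mul :: "real^4 \<Rightarrow> real^4 \<Rightarrow> real^4" where
  "engel_mul p q = p + q + (1/2) *\<^sub>R engel_bracket p q
     + (1/12) *\<^sub>R engel_bracket p (engel_bracket p q)
     + (1/12) *\<^sub>R engel_bracket q (engel_bracket q p)"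

definition engel_exp :: "real^4 \<Rightarrow> real^4" where
  "engel_exp X = X"

lemma engel_mul_assoc: "engel_mul (engel_mul p q) r = engel_mul p (engel_mul q r)"
  by (simp add: vec_eq_iff forall_4 engel_mul_def field_simps)

lemma engel_mul_zero: "engel_mul 0 p = p" "engel_mul p 0 = p"
  by (simp_all add: vec_eq_iff forall_4 engel_mul_def)

lemma engel_mul_minus: "engel_mul (- p) p = 0" "engel_mul p (- p) = 0"
  by (simp_all add: vec_eq_iff forall_4 engel_mul_def)

lemma engel_exp_one_parameter:
  "engel_exp ((s + t) *\<^sub>R X) = engel_mul (engel_exp (s *\<^sub>R X)) (engel_exp (t *\<^sub>R X))"
  by (simp add: vec_eq_iff forall_4 engel_mul_def engel_exp_def algebra_simps)

lemma engel_exp_has_vector_derivative: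
  "((\<lambda>t. engel_exp (t *\<^sub>R X)) has_vector_derivative X) (at 0)"
  unfolding engel_exp_def by (auto intro!: derivative_eq_intros)

text \<open>The left-invariant vector field on the group whose value at the identity is \<open>X\<close>.\<close>

definition engel_field :: "real^4 \<Rightarrow> real^4 \<Rightarrow> real^4" where
  "engel_field X p = vector_derivative (\<lambda>t. engel_mul p (engel_exp (t *\<^sub>R X))) (at 0)"

lemma engel_field_explicit:
  shows has_vector_derivative_engel_field:
      "((\<lambda>t. engel_mul p (engel_exp (t *\<^sub>R X))) has_vector_derivative engel_field X p) (at 0)"
    and engel_field_eq:
      "engel_field X p =
         X + (1/2) *\<^sub>R engel_bracket p X + (1/12) *\<^sub>R engel_bracket p (engel_bracket p X)"
proof -
  have 1: "engel_mul p (engel_exp (t *\<^sub>R X)) = p + t *\<^sub>R (X + (1/2) *\<^sub>R engel_bracket p X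
      + (1/12) *\<^sub>R engel_bracket p (engel_bracket p X))
      + t^2 *\<^sub>R ((1/12) *\<^sub>R engel_bracket X (engel_bracket X p))" for t
    by (simp add: vec_eq_iff forall_4 engel_mul_def engel_exp_def field_simps power2_eq_square)
  have 2: "((\<lambda>t. engel_mul p (engel_exp (t *\<^sub>R X))) has_vector_derivative
      X + (1/2) *\<^sub>R engel_bracket p X + (1/12) *\<^sub>R engel_bracket p (engel_bracket p X)) (at 0)"
    unfolding 1 by (auto intro!: derivative_eq_intros)
  show 3: "engel_field X p =
      X + (1/2) *\<^sub>R engel_bracket p X + (1/12) *\<^sub>R engel_bracket p (engel_bracket p X)"
    unfolding engel_field_def by (rule vector_derivative_at[OF 2])
  show "((\<lambda>t. engel_mul p (engel_exp (t *\<^sub>R X))) has_vector_derivative engel_field X p) (at 0)"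
    using 2 unfolding 3 .
qed

lemma engel_field_bracket:
  assumes "(engel_field X has_derivative DX) (at p)" "(engel_field Y has_derivative DY) (at p)"
  shows "DY (engel_field X p) - DX (engel_field Y p) = engel_field (engel_bracket X Y) p"
proof -
  have D: "(engel_field Z has_derivative
      (\<lambda>w. (1/2) *\<^sub>R engel_bracket w Z + (1/12) *\<^sub>R (engel_bracket w (engel_bracket p Z)
        + engel_bracket p (engel_bracket w Z)))) (at p)" for Z
  proof -
    have "bounded_bilinear engel_bracket"
      using engel_bracket_bilinear bilinear_conv_bounded_bilinear by blast
    note * = bounded_bilinear.FDERIV[OF this]
    show ?thesis
      unfolding engel_field_eq[abs_def]
      by (rule derivative_eq_intros * refl)+
         (simp add: vec_eq_iff forall_4 algebra_simps fun_eq_iff)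
  qed
  have "DX = (\<lambda>w. (1/2) *\<^sub>R engel_bracket w X + (1/12) *\<^sub>R (engel_bracket w (engel_bracket p X)
        + engel_bracket p (engel_bracket w X)))"
       "DY = (\<lambda>w. (1/2) *\<^sub>R engel_bracket w Y + (1/12) *\<^sub>R (engel_bracket w (engel_bracket p Y)
        + engel_bracket p (engel_bracket w Y)))"
    using assms D has_derivative_unique by blast+
  then show ?thesis
    by (simp add: vec_eq_iff forall_4 engel_field_eq field_simps)
qed

definition engel_V1 :: "(real^4) set" where
  "engel_V1 = span {engel_X 1, engel_X 2}"

definition engel_Psi :: "real^4 \<Rightarrow> real^4" where
  "engel_Psi x =
     engel_mul (engel_mul (engel_mul (engel_exp (x$4 *\<^sub>R engel_X 4)) (engel_exp (x$3 *\<^sub>R engel_X 3)))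
       (engel_exp (x$2 *\<^sub>R engel_X 2))) (engel_exp (x$1 *\<^sub>R engel_X 1))"

definition haar_measure :: "(real^4) measure \<Rightarrow> bool" where
  "haar_measure \<mu> \<longleftrightarrow> sets \<mu> = sets borel
     \<and> (\<forall>g. \<forall>A\<in>sets borel. emeasure \<mu> (engel_mul g ` A) = emeasure \<mu> A)
     \<and> (\<forall>K. compact K \<longrightarrow> emeasure \<mu> K < \<infinity>)
     \<and> (\<forall>U. open U \<longrightarrow> U \<noteq> {} \<longrightarrow> emeasure \<mu> U > 0)"

lemma engel_mul_image_lborel:
  assumes A: "A \<in> sets borel"
  shows "engel_mul g ` A \<in> sets borel"
    and "emeasure lborel (engel_mul g ` A) = emeasure lborel A"
proof -
  have cont: "continuous_on UNIV (engel_mul h)" for h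
  proof -
    have "bounded_bilinear engel_bracket"
      using engel_bracket_bilinear bilinear_conv_bounded_bilinear by blast
    note * = bounded_bilinear.continuous_on[OF this]
    show ?thesis
      unfolding engel_mul_def[abs_def] by (intro continuous_intros *)
  qed
  have "engel_mul g ` A = engel_mul (- g) -` A"
    by (force simp flip: engel_mul_assoc simp: engel_mul_minus engel_mul_zero image_iff)
  moreover have "engel_mul (- g) \<in> borel_measurable borel"
    by (rule borel_measurable_continuous_onI[OF cont])
  ultimately show B: "engel_mul g ` A \<in> sets borel"
    using measurable_sets[of "engel_mul (- g)" borel borel A] A by simp
  define D where "D = (\<lambda>p w. w + (1/2) *\<^sub>R engel_bracket g w
     + (1/12) *\<^sub>R engel_bracket g (engel_bracket g w)
     + (1/12) *\<^sub>R (engel_bracket p (engel_bracket w g) + engel_bracket w (engel_bracket p g)))"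
  have der: "(engel_mul g has_derivative D p) (at p within A)" for p
  proof -
    have "bounded_bilinear engel_bracket"
      using engel_bracket_bilinear bilinear_conv_bounded_bilinear by blast
    note * = bounded_bilinear.FDERIV[OF this]
    show ?thesis
      unfolding engel_mul_def[abs_def]
      by (rule derivative_eq_intros * refl)+
         (simp add: D_def vec_eq_iff forall_4 algebra_simps fun_eq_iff)
  qed
  have det: "det (matrix (D p)) = 1" for p
  proof -
    define M where "M = matrix (D p)"
    have M: "M$i$i = 1" "M$1$2 = 0" "M$1$3 = 0" "M$1$4 = 0" "M$2$1 = 0" "M$2$3 = 0" "M$2$4 = 0"
      "M$3$4 = 0" for i
      using exhaust_4[of i] by (auto simp: M_def matrix_def D_def axis_def)
    have perm_id: "\<pi> = id" if perm: "\<pi> permutes UNIV" and nz: "\<forall>i. M$i$\<pi> i \<noteq> 0" for \<pi>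
    proof -
      have 1: "\<pi> 1 = 1" and 2: "\<pi> 2 = 2"
        using nz[rule_format, of 1] exhaust_4[of "\<pi> 1"] nz[rule_format, of 2] exhaust_4[of "\<pi> 2"] M
        by auto
      have inj: "\<pi> i \<noteq> \<pi> j" if "i \<noteq> j" for i j
        using permutes_inj[OF perm] that by (auto dest: injD)
      have 3: "\<pi> 3 = 3"
        using nz[rule_format, of 3] exhaust_4[of "\<pi> 3"] M inj[of 3 1] inj[of 3 2] 1 2 by auto
      have "\<pi> 4 = 4"
        using exhaust_4[of "\<pi> 4"] inj[of 4 1] inj[of 4 2] inj[of 4 3] 1 2 3 by auto
      then have "\<pi> i = i" for i
        using 1 2 3 exhaust_4[of i] by auto
      then show ?thesis by (simp add: fun_eq_iff)
    qed
    have "det M = (\<Sum>\<pi> | \<pi> permutes (UNIV :: 4 set). if \<pi> = id then 1 else 0)"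
      unfolding det_def
    proof (rule sum.cong[OF refl], clarify)
      fix \<pi> :: "4 \<Rightarrow> 4"
      assume "\<pi> permutes UNIV"
      then have "\<exists>i. M$i$\<pi> i = 0" if "\<pi> \<noteq> id"
        using perm_id that by blast
      then have "(\<Prod>i\<in>UNIV. M$i$\<pi> i) = 0" if "\<pi> \<noteq> id"
        using that by (simp add: prod_zero_iff)
      then show "of_int (sign \<pi>) * (\<Prod>i\<in>UNIV. M$i$\<pi> i) = (if \<pi> = id then 1 else 0)"
        by (simp add: M sign_id)
    qed
    also have "\<dots> = 1"
      by (simp add: finite_permutations permutes_id)
    finally show ?thesis by (simp add: M_def)
  qed
  have inj: "inj_on (engel_mul g) A"
    by (rule inj_on_inverseI[of _ "engel_mul (- g)"])
       (simp flip: engel_mul_assoc add: engel_mul_minus engel_mul_zero)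
  have AL: "A \<in> sets lebesgue" using A by auto
  have BL: "engel_mul g ` A \<in> sets lebesgue" using B by auto
  note hm = has_measure_differentiable_image[OF AL der inj, unfolded det]
  have iff: "((\<lambda>x. \<bar>1::real\<bar>) has_integral m) A \<longleftrightarrow> A \<in> lmeasurable \<and> measure lebesgue A = m" for m
    by (simp add: has_integral_iff lmeasure_integral lmeasurable_iff_integrable_on cong: conj_cong)
  have "emeasure lebesgue (engel_mul g ` A) = emeasure lebesgue A"
  proof (cases "A \<in> lmeasurable")
    case True
    then have "engel_mul g ` A \<in> lmeasurable" "measure lebesgue (engel_mul g ` A) = measure lebesgue A"
      using hm[of "measure lebesgue A"] iff by auto
    then show ?thesis using True
      by (simp add: emeasure_eq_measure2 fmeasurableD2)
  next
    case False
    then have "engel_mul g ` A \<notin> lmeasurable"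
      using hm iff by blast
    then have "emeasure lebesgue A = \<infinity>" "emeasure lebesgue (engel_mul g ` A) = \<infinity>"
      using False AL BL fmeasurableI top.not_eq_extremum infinity_ennreal_def by metis+
    then show ?thesis by simp
  qed
  then show "emeasure lborel (engel_mul g ` A) = emeasure lborel A"
    using A B by (simp add: emeasure_completion)
qed

lemma haar_measure_lborel: "haar_measure lborel"
proof -
  have "emeasure lborel U > 0" if "open U" "U \<noteq> {}" for U :: "(real^4) set"
  proof (rule ccontr)
    assume "\<not> emeasure lborel U > 0"
    then have "U \<in> null_sets lborel"
      using that(1) by (auto simp: null_sets_def)
    then have "negligible U"
      by (simp add: negligible_iff_null_sets null_sets_completionI)
    then show False
      using open_not_negligible that by blast
  qed
  then show ?thesis
    unfolding haar_measure_def
    using engel_mul_image_lborel(2) emeasure_compact_finite by auto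
qed

fun C_k :: "nat \<Rightarrow> (real^4 \<Rightarrow> real) \<Rightarrow> bool" where
  "C_k 0 f \<longleftrightarrow> continuous_on UNIV f"
| "C_k (Suc k) f \<longleftrightarrow> (\<forall>x. f differentiable (at x))
     \<and> (\<forall>v. C_k k (\<lambda>x. frechet_derivative f (at x) v))"

definition test_function :: "(real^4 \<Rightarrow> real) \<Rightarrow> bool" where
  "test_function \<phi> \<longleftrightarrow> (\<forall>k. C_k k \<phi>) \<and> compact (closure {p. \<phi> p \<noteq> 0})"

text \<open>The action of \<open>X\<close>, as a left-invariant vector field, on functions.\<close>

definition left_inv_deriv :: "real^4 \<Rightarrow> (real^4 \<Rightarrow> real) \<Rightarrow> real^4 \<Rightarrow> real" where
  "left_inv_deriv X \<phi> p = deriv (\<lambda>t. \<phi> (engel_mul p (engel_exp (t *\<^sub>R X)))) 0"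

lemma left_inv_deriv_eq:
  assumes "\<phi> differentiable (at p)"
  shows "left_inv_deriv X \<phi> p = frechet_derivative \<phi> (at p) (engel_field X p)"
proof -
  have p: "engel_mul p (engel_exp (0 *\<^sub>R X)) = p"
    by (simp add: engel_exp_def engel_mul_zero)
  have "(\<phi> has_derivative frechet_derivative \<phi> (at p))
      (at (engel_mul p (engel_exp (0 *\<^sub>R X))) within range (\<lambda>t. engel_mul p (engel_exp (t *\<^sub>R X))))"
    unfolding p using assms frechet_derivative_works has_derivative_at_withinI by blast
  from vector_derivative_diff_chain_within[OF has_vector_derivative_engel_field this]
  have "((\<lambda>t. \<phi> (engel_mul p (engel_exp (t *\<^sub>R X)))) has_real_derivative
      frechet_derivative \<phi> (at p) (engel_field X p)) (at 0)"
    by (simp add: o_def has_real_derivative_iff_has_vector_derivative)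
  then show ?thesis
    unfolding left_inv_deriv_def by (rule DERIV_imp_deriv)
qed

text \<open>
  Haar measures are taken on the Borel sets; measurability, integrals over \<open>E\<close> and null sets
  refer to the completion.
\<close>

definition deriv_indicator_nonneg :: "(real^4) measure \<Rightarrow> real^4 \<Rightarrow> (real^4) set \<Rightarrow> bool" where
  "deriv_indicator_nonneg \<mu> X E \<longleftrightarrow>
     (\<forall>\<phi>. test_function \<phi> \<and> (\<forall>p. \<phi> p \<ge> 0) \<longrightarrow>
        - set_lebesgue_integral (completion \<mu>) E (left_inv_deriv X \<phi>) \<ge> 0)"

definition deriv_indicator_zero :: "(real^4) measure \<Rightarrow> real^4 \<Rightarrow> (real^4) set \<Rightarrow> bool" where
  "deriv_indicator_zero \<mu> X E \<longleftrightarrow>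
     (\<forall>\<phi>. test_function \<phi> \<and> (\<forall>p. \<phi> p \<ge> 0) \<longrightarrow>
        set_lebesgue_integral (completion \<mu>) E (left_inv_deriv X \<phi>) = 0)"

text \<open>Only the restriction of the form to the subspace \<open>V\<close> matters.\<close>

definition scalar_product_on :: "(real^4) set \<Rightarrow> (real^4 \<Rightarrow> real^4 \<Rightarrow> real) \<Rightarrow> bool" where
  "scalar_product_on V ip \<longleftrightarrow>
     (\<forall>x\<in>V. \<forall>y\<in>V. ip x y = ip y x)
     \<and> (\<forall>x\<in>V. \<forall>y\<in>V. \<forall>z\<in>V. ip (x + y) z = ip x z + ip y z)
     \<and> (\<forall>c. \<forall>x\<in>V. \<forall>y\<in>V. ip (c *\<^sub>R x) y = c * ip x y)
     \<and> (\<forall>x\<in>V. x \<noteq> 0 \<longrightarrow> ip x x > 0)"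

definition constant_horizontal_normal ::
    "(real^4) measure \<Rightarrow> (real^4 \<Rightarrow> real^4 \<Rightarrow> real) \<Rightarrow> (real^4) set \<Rightarrow> real^4 \<Rightarrow> bool" where
  "constant_horizontal_normal \<mu> ip E X \<longleftrightarrow>
     E \<in> sets (completion \<mu>) \<and> X \<in> engel_V1 \<and> deriv_indicator_nonneg \<mu> X E
     \<and> (\<forall>Y\<in>engel_V1. ip X Y = 0 \<longrightarrow> deriv_indicator_zero \<mu> Y E)"

text \<open>The symmetric difference is required to be measurable; for a non-measurable set
  \<open>emeasure\<close> would be \<open>0\<close>.\<close>

definition vol_equivalent :: "(real^4) measure \<Rightarrow> (real^4) set \<Rightarrow> (real^4) set \<Rightarrow> bool" where
  "vol_equivalent \<mu> E F \<longleftrightarrow> (E - F) \<union> (F - E) \<in> null_sets (completion \<mu>)"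

end

theory Submission
  imports Defs
begin

text \<open>
  Let \<open>Y\<close> span the orthogonal complement of \<open>X \<noteq> 0\<close> in the horizontal layer. The directions \<open>Z\<close> with
  \<open>Z 1\<^sub>E \<ge> 0\<close> form a closed convex cone, which contains \<open>X\<close> and \<open>\<plusminus>Y\<close> and is invariant under
  \<open>Ad (exp (s Y))\<close>. Since \<open>X\<close> and \<open>\<plusminus>Y\<close> generate a half-plane, \<open>\<sigma> X\<^sub>1\<close> and \<open>\<epsilon> X\<^sub>2\<close> lie in the cone
  for some signs \<open>\<sigma>\<close>, \<open>\<epsilon>\<close>; conjugation and passage to the limit then give
  \<open>\<epsilon> (X\<^sub>2 + s X\<^sub>3 + s\<^sup>2/2 X\<^sub>4)\<close> for all \<open>s\<close>, and \<open>\<epsilon> X\<^sub>4\<close>. (If \<open>Y\<close> is parallel to \<open>X\<^sub>2\<close>, conjugation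
  shows instead that \<open>E\<close> is invariant along \<open>X\<^sub>2\<close>, \<open>X\<^sub>3\<close> and \<open>X\<^sub>4\<close>.)

  In exponential coordinates of the second kind \<open>X\<^sub>1 = \<partial>\<^sub>1\<close> and
  \<open>X\<^sub>2 + s X\<^sub>3 + s\<^sup>2/2 X\<^sub>4 = \<partial>\<^sub>2 + (x\<^sub>1 + s) \<partial>\<^sub>3 + (x\<^sub>1 + s)\<^sup>2/2 \<partial>\<^sub>4\<close>, so composing the flows of these
  fields carries almost every point of \<open>E\<close>, for almost every choice of the times, to a point of \<open>E\<close>,
  and the displacements fill the translates of a fixed open convex cone, which depends on the two
  signs only. A set with this property is the epigraph of a Lipschitz function, whose constant is
  determined by the cone.
\<close>

section \<open>Smooth functions\<close>

definition smooth :: "(real^4 \<Rightarrow> real) \<Rightarrow> bool" where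
  "smooth f \<longleftrightarrow> (\<forall>k. C_k k f)"

lemma smooth_has_derivative:
  assumes "smooth f"
  shows "(f has_derivative frechet_derivative f (at x)) (at x)"
  using assms C_k.simps(2)[of 0 f] by (auto simp: smooth_def frechet_derivative_works simp del: C_k.simps)

lemma smooth_linear_frechet_derivative:
  "smooth f \<Longrightarrow> linear (frechet_derivative f (at x))"
  using smooth_has_derivative has_derivative_linear by blast

lemma smooth_frechet_derivative:
  assumes "smooth f"
  shows "smooth (\<lambda>x. frechet_derivative f (at x) v)"
  unfolding smooth_def
proof
  fix k
  have "C_k (Suc k) f" using assms by (simp add: smooth_def del: C_k.simps)
  then show "C_k k (\<lambda>x. frechet_derivative f (at x) v)" by simp
qed

lemma smooth_continuous: "smooth f \<Longrightarrow> continuous_on S f"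
  unfolding smooth_def using C_k.simps(1) continuous_on_subset by blast

text \<open>Each \<open>C_k\<close> asks for one more round of directional derivatives, so a class
  of functions closed under these consists of smooth functions by induction on \<open>k\<close>.
  Higher derivatives never have to be computed.\<close>

lemma smooth_coinduct:
  assumes "P f"
    and "\<And>f. P f \<Longrightarrow> \<exists>f'. (\<forall>x. (f has_derivative f' x) (at x)) \<and> (\<forall>v. P (\<lambda>x. f' x v))"
  shows "smooth f"
proof -
  have "C_k k f" if "P f" for k f
    using that
  proof (induction k arbitrary: f)
    case 0
    then obtain f' where "\<And>x. (f has_derivative f' x) (at x)" using assms(2) by blast
    then show ?case
      by (auto intro!: continuous_at_imp_continuous_on has_derivative_continuous)
  next
    case (Suc k)
    then obtain f' where f': "\<And>x. (f has_derivative f' x) (at x)" "\<And>v. P (\<lambda>x. f' x v)"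
      using assms(2) by blast
    then have "frechet_derivative f (at x) = f' x" for x
      using frechet_derivative_at by metis
    then show ?case using f' Suc.IH by (auto simp: differentiable_def)
  qed
  then show ?thesis using assms(1) by (simp add: smooth_def)
qed

text \<open>There is no clause for scalars: every \<open>A\<close> used below contains
  \<open>Collect smooth\<close>, so constants are generators.\<close>

inductive alg_hull :: "(real^4 \<Rightarrow> real) set \<Rightarrow> (real^4 \<Rightarrow> real) \<Rightarrow> bool" for A where
  base: "f \<in> A \<Longrightarrow> alg_hull A f"
| add: "alg_hull A f \<Longrightarrow> alg_hull A g \<Longrightarrow> alg_hull A (\<lambda>x. f x + g x)"
| mult: "alg_hull A f \<Longrightarrow> alg_hull A g \<Longrightarrow> alg_hull A (\<lambda>x. f x * g x)"

text \<open>By the product rule the derivatives stay in the algebra as soon as those of the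
  generators do.\<close>

lemma smooth_alg_hull:
  assumes "alg_hull A f"
    and gen: "\<And>f. f \<in> A \<Longrightarrow>
      \<exists>f'. (\<forall>x. (f has_derivative f' x) (at x)) \<and> (\<forall>v. alg_hull A (\<lambda>x. f' x v))"
  shows "smooth f"
proof (rule smooth_coinduct[of "alg_hull A"])
  fix f
  assume "alg_hull A f"
  then show "\<exists>f'. (\<forall>x. (f has_derivative f' x) (at x)) \<and> (\<forall>v. alg_hull A (\<lambda>x. f' x v))"
  proof induction
    case (base f)
    then show ?case by (rule gen)
  next
    case (add f g)
    then obtain f' g' where "\<forall>x. (f has_derivative f' x) (at x)" "\<forall>x. (g has_derivative g' x) (at x)"
      "\<forall>v. alg_hull A (\<lambda>x. f' x v)" "\<forall>v. alg_hull A (\<lambda>x. g' x v)" by blast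
    then show ?case
      by (intro exI[of _ "\<lambda>x v. f' x v + g' x v"]) (auto intro: has_derivative_add alg_hull.add)
  next
    case (mult f g)
    then obtain f' g' where "\<forall>x. (f has_derivative f' x) (at x)" "\<forall>x. (g has_derivative g' x) (at x)"
      "\<forall>v. alg_hull A (\<lambda>x. f' x v)" "\<forall>v. alg_hull A (\<lambda>x. g' x v)" by blast
    with mult.hyps show ?case
      by (intro exI[of _ "\<lambda>x v. f x * g' x v + f' x v * g x"] conjI allI
            has_derivative_mult alg_hull.add[OF alg_hull.mult alg_hull.mult]) auto
  qed
qed (fact assms(1))

lemma smooth_generator:
  assumes "smooth f" "Collect smooth \<subseteq> A"
  shows "\<exists>f'. (\<forall>x. (f has_derivative f' x) (at x)) \<and> (\<forall>v. alg_hull A (\<lambda>x. f' x v))"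
  using assms smooth_has_derivative smooth_frechet_derivative
  by (intro exI[of _ "\<lambda>x. frechet_derivative f (at x)"]) (auto intro!: alg_hull.base)

lemma smooth_add: "smooth f \<Longrightarrow> smooth g \<Longrightarrow> smooth (\<lambda>x. f x + g x)"
  by (rule smooth_alg_hull[of "Collect smooth"])
     (auto intro: alg_hull.intros smooth_generator)

lemma smooth_mult: "smooth f \<Longrightarrow> smooth g \<Longrightarrow> smooth (\<lambda>x. f x * g x)"
  by (rule smooth_alg_hull[of "Collect smooth"])
     (auto intro: alg_hull.intros smooth_generator)

lemma smooth_const: "smooth (\<lambda>x. c)"
  by (rule smooth_coinduct[of "\<lambda>f. \<exists>c. f = (\<lambda>x. c)"])
     (auto intro!: exI[of _ "\<lambda>x v. 0"])

lemma smooth_nth: "smooth (\<lambda>x. x $ i)"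
  by (rule smooth_coinduct[of "\<lambda>f. f = (\<lambda>x. x $ i) \<or> smooth f"])
     (auto intro: exI[of _ "\<lambda>x v. v $ i"] exI[of _ "\<lambda>x. frechet_derivative f (at x)" for f]
        bounded_linear_imp_has_derivative smooth_const
        bounded_linear_vec_nth smooth_has_derivative smooth_frechet_derivative)

lemma smooth_diff: "smooth f \<Longrightarrow> smooth g \<Longrightarrow> smooth (\<lambda>x. f x - g x)"
  using smooth_add[OF _ smooth_mult[OF smooth_const[of "-1"]], of f g] by simp

lemma smooth_power: "smooth f \<Longrightarrow> smooth (\<lambda>x. f x ^ n)"
  by (induction n) (auto intro: smooth_const smooth_mult)

lemma smooth_sum: "(\<And>i. i \<in> I \<Longrightarrow> smooth (f i)) \<Longrightarrow> smooth (\<lambda>x. \<Sum>i\<in>I. f i x)"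
  by (induction I rule: infinite_finite_induct) (auto intro: smooth_const smooth_add)

lemma smooth_divide: "smooth f \<Longrightarrow> smooth (\<lambda>x. f x / c)"
  using smooth_mult[OF _ smooth_const[of "inverse c"], of f] by (simp add: divide_inverse)

lemmas smooth_intros = smooth_const smooth_divide smooth_nth smooth_add smooth_diff smooth_mult smooth_power smooth_sum

text \<open>The chain rule produces partial derivatives of \<open>g\<close> at \<open>P x\<close>,
  multiplied by derivatives of the components of \<open>P\<close>. Hence the algebra generated by
  the compositions with \<open>P\<close> together with the smooth functions is closed under
  differentiation.\<close>

lemma smooth_compose:
  assumes g: "smooth g" and P: "\<And>i. smooth (\<lambda>x. P x $ i)"
  shows "smooth (\<lambda>x. g (P x))"
proof -
  define A where "A = (\<lambda>g x. g (P x)) ` Collect smooth \<union> Collect smooth"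
  define P' where "P' x v = (\<chi> i. frechet_derivative (\<lambda>x. P x $ i) (at x) v)" for x v
  have P': "(P has_derivative P' x) (at x)" for x
    unfolding has_derivative_componentwise_within[of P] Basis_vec_def
    using smooth_has_derivative[OF P] by (auto simp: inner_axis P'_def)
  have D: "frechet_derivative g (at (P x)) (P' x v) = (\<Sum>i\<in>UNIV. P' x v $ i * frechet_derivative g (at (P x)) (axis i 1))"
    if "smooth g" for g x v
  proof -
    have "linear (frechet_derivative g (at (P x)))"
      by (rule smooth_linear_frechet_derivative[OF that])
    from linear_sum[OF this, of "\<lambda>i. P' x v $ i *\<^sub>R axis i 1" UNIV] show ?thesis
      using basis_expansion[of "P' x v"] linear_cmul[OF \<open>linear _\<close>]
      by (simp add: scalar_mult_eq_scaleR)
  qed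
  have *: "alg_hull A f" if "smooth f" for f
    using that by (auto simp: A_def intro: alg_hull.base)
  have **: "alg_hull A (\<lambda>x. f (P x))" if "smooth f" for f
    using that by (auto simp: A_def intro: alg_hull.base)
  show ?thesis
  proof (rule smooth_alg_hull[of A])
    show "alg_hull A (\<lambda>x. g (P x))" using g by (auto simp: A_def intro: alg_hull.base)
    fix f assume "f \<in> A"
    then consider "smooth f" | g where "smooth g" "f = (\<lambda>x. g (P x))" by (auto simp: A_def)
    then show "\<exists>f'. (\<forall>x. (f has_derivative f' x) (at x)) \<and> (\<forall>v. alg_hull A (\<lambda>x. f' x v))"
    proof cases
      case 1
      then show ?thesis by (rule smooth_generator) (auto simp: A_def)
    next
      case 2
      have "(f has_derivative (\<lambda>v. frechet_derivative g (at (P x)) (P' x v))) (at x)" for x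
        unfolding 2(2) using has_derivative_compose[OF P' smooth_has_derivative[OF 2(1)]] .
      moreover have "alg_hull A (\<lambda>x. frechet_derivative g (at (P x)) (P' x v))" for v
        unfolding D[OF 2(1)] sum_4 unfolding P'_def vec_lambda_beta
        by (intro alg_hull.add alg_hull.mult *[OF smooth_frechet_derivative[OF P]]
              **[OF smooth_frechet_derivative[OF 2(1)]])
      ultimately show ?thesis
        by (intro exI[of _ "\<lambda>x v. frechet_derivative g (at (P x)) (P' x v)"]) simp
    qed
  qed
qed

section \<open>Flat functions and bump functions\<close>

definition flat :: "nat \<Rightarrow> real \<Rightarrow> real" where
  "flat k x = (if x > 0 then exp (- 1 / x) / x ^ k else 0)"

text \<open>The index \<open>k\<close> is there because \<open>exp (- 1 / x)\<close> alone is not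
  stable under differentiation, whereas the span of the whole family is.\<close>

lemma flat_has_real_derivative:
  "(flat k has_real_derivative flat (k + 2) x - real k * flat (k + 1) x) (at x)"
proof -
  consider "x < 0" | "x = 0" | "x > 0" by linarith
  then show ?thesis
  proof cases
    case 1
    have "((\<lambda>x. 0) has_real_derivative 0) (at x)" by simp
    then have "(flat k has_real_derivative 0) (at x)"
      by (rule DERIV_cong_ev[THEN iffD1, rotated -1])
         (use 1 in \<open>auto simp: flat_def intro!: eventually_mono[OF order_tendstoD(2)[OF tendsto_ident_at, of x 0 UNIV]] simp: eventually_nhds_conv_at\<close>)
    then show ?thesis using 1 by (simp add: flat_def)
  next
    case 2
    \<comment> \<open>This is the difference quotient at 0, as \<open>flat k 0 = 0\<close>. The
      substitution \<open>z = 1 / y\<close> turns it into \<open>z ^ (k + 1) / exp z\<close>, which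
      vanishes at infinity.\<close>
    have "((\<lambda>y. flat k y / y) \<longlongrightarrow> 0) (at_right 0)"
    proof -
      have "((\<lambda>y::real. exp (- 1 / y) / y ^ (k + 1)) \<longlongrightarrow> 0) (at_right 0)"
      proof -
        have "((\<lambda>z::real. z ^ (k + 1) / exp z) \<longlongrightarrow> 0) at_top" by (rule tendsto_power_div_exp_0)
        then have "((\<lambda>y::real. (inverse y) ^ (k + 1) / exp (inverse y)) \<longlongrightarrow> 0) (at_right 0)"
          by (rule filterlim_compose[OF _ filterlim_inverse_at_top_right])
        then show ?thesis by (simp add: exp_minus field_simps)
      qed
      then show ?thesis
        by (rule Lim_transform_eventually)
           (auto simp: flat_def field_simps intro!: eventually_mono[OF eventually_at_right_less])
    qed
    moreover have "((\<lambda>y. flat k y / y) \<longlongrightarrow> 0) (at_left 0)"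
      by (rule Lim_transform_eventually[OF tendsto_const])
         (auto simp: flat_def eventually_at_filter)
    ultimately show ?thesis
      using 2 by (simp add: has_field_derivative_iff flat_def filterlim_split_at)
  next
    case 3
    have "((\<lambda>x. exp (- 1 / x) / x ^ k) has_real_derivative
        flat (k + 2) x - real k * flat (k + 1) x) (at x)"
      using 3 by (auto intro!: derivative_eq_intros simp: flat_def)
        (cases k; simp add: field_simps power2_eq_square)
    then show ?thesis
      by (rule DERIV_cong_ev[THEN iffD1, rotated -1])
         (use 3 in \<open>auto simp: flat_def intro!: eventually_mono[OF order_tendstoD(1)[OF tendsto_ident_at, of 0 x UNIV]] simp: eventually_nhds_conv_at\<close>)
  qed
qed

lemma smooth_flat:
  assumes f: "smooth f"
  shows "smooth (\<lambda>x. flat k (f x))"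
proof -
  define A where "A = range (\<lambda>k x. flat k (f x)) \<union> Collect smooth"
  have *: "alg_hull A f" if "smooth f" for f
    using that by (auto simp: A_def intro: alg_hull.base)
  have **: "alg_hull A (\<lambda>x. flat k (f x))" for k
    by (auto simp: A_def intro: alg_hull.base)
  show ?thesis
  proof (rule smooth_alg_hull[of A, OF **])
    fix g assume "g \<in> A"
    then consider "smooth g" | k where "g = (\<lambda>x. flat k (f x))" by (auto simp: A_def)
    then show "\<exists>f'. (\<forall>x. (g has_derivative f' x) (at x)) \<and> (\<forall>v. alg_hull A (\<lambda>x. f' x v))"
    proof cases
      case 1
      then show ?thesis by (rule smooth_generator) (auto simp: A_def)
    next
      case 2
      let ?d = "\<lambda>x v. (flat (k + 2) (f x) + (- real k) * flat (k + 1) (f x)) * frechet_derivative f (at x) v"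
      have "(g has_derivative ?d x) (at x)" for x
        unfolding 2
        using has_derivative_compose[OF smooth_has_derivative[OF f]
            flat_has_real_derivative[unfolded has_field_derivative_def]] by simp
      moreover have "alg_hull A (\<lambda>x. ?d x v)" for v
        by (intro alg_hull.add alg_hull.mult * ** smooth_const smooth_frechet_derivative f)
      ultimately show ?thesis by (intro exI[of _ ?d]) simp
    qed
  qed
qed

lemma test_function_iff: "test_function \<phi> \<longleftrightarrow> smooth \<phi> \<and> bounded {p. \<phi> p \<noteq> 0}"
  by (simp add: test_function_def smooth_def)

text \<open>The squared distance to \<open>c\<close> is a polynomial in the coordinates, so
  \<open>flat 0\<close> of \<open>r\<^sup>2\<close> minus this distance is smooth. The bound 1 makes
  powers of \<open>1 - \<psi>\<close> usable in \<open>AE_of_test_functions\<close>.\<close>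

lemma test_function_ball:
  assumes "r > 0"
  obtains \<psi> where "test_function \<psi>" "\<And>p. 0 \<le> \<psi> p" "\<And>p. \<psi> p \<le> 1" "{p. \<psi> p \<noteq> 0} = ball c r"
proof
  let ?\<psi> = "\<lambda>p. flat 0 (r\<^sup>2 - (\<Sum>i\<in>UNIV. (p $ i - c $ i)\<^sup>2))"
  have n: "(\<Sum>i\<in>UNIV. (p $ i - c $ i)\<^sup>2) = (dist c p)\<^sup>2" for p
    by (simp add: dist_vec_def L2_set_def sum_nonneg dist_commute[of "c$i" for i] dist_norm power2_commute)
  show s: "{p. ?\<psi> p \<noteq> 0} = ball c r"
    using assms unfolding n by (auto simp: flat_def power2_less_imp_less abs_le_square_iff power_mono) 
      (meson less_eq_real_def not_le power_strict_mono zero_le_dist zero_less_numeral)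
  have "smooth ?\<psi>" by (intro smooth_flat smooth_intros)
  then show "test_function ?\<psi>"
    unfolding test_function_iff s by simp
  show "0 \<le> ?\<psi> p" "?\<psi> p \<le> 1" for p
    by (auto simp: flat_def)
qed

section \<open>Invariance and uniqueness of the Haar measure\<close>

lemma bounded_bilinear_engel_bracket: "bounded_bilinear engel_bracket"
  using engel_bracket_bilinear bilinear_conv_bounded_bilinear by blast

lemma continuous_on_engel_mul [continuous_intros]:
  assumes "continuous_on S f" "continuous_on S g"
  shows "continuous_on S (\<lambda>x. engel_mul (f x) (g x))"
  unfolding engel_mul_def
  by (intro continuous_intros assms bounded_bilinear.continuous_on[OF bounded_bilinear_engel_bracket])

lemma measurable_engel_mul [measurable (raw)]:
  assumes "f \<in> borel_measurable M" "g \<in> borel_measurable M"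
  shows "(\<lambda>x. engel_mul (f x) (g x)) \<in> borel_measurable M"
proof -
  have "(\<lambda>z. engel_mul (fst z) (snd z)) \<in> borel_measurable borel"
    by (intro borel_measurable_continuous_onI continuous_intros)
  from measurable_compose[OF borel_measurable_Pair[OF assms] this] show ?thesis by simp
qed

lemma engel_mul_cancel [simp]:
  "engel_mul (- p) (engel_mul p q) = q" "engel_mul p (engel_mul (- p) q) = q"
  "engel_mul (engel_mul q p) (- p) = q" "engel_mul (engel_mul q (- p)) p = q"
  by (simp_all flip: engel_mul_assoc add: engel_mul_minus engel_mul_zero)
     (simp_all add: engel_mul_assoc engel_mul_minus engel_mul_zero)

lemma engel_mul_inverse: "- engel_mul p q = engel_mul (- q) (- p)"
  by (simp add: vec_eq_iff forall_4 engel_mul_def field_simps)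

lemma continuous_on_engel_mul_left [continuous_intros]: "continuous_on S (engel_mul g)"
  by (intro continuous_on_engel_mul continuous_intros)

lemma distr_engel_mul_left:
  assumes M: "sets M = sets borel"
    and inv: "\<And>g A. A \<in> sets borel \<Longrightarrow> emeasure M (engel_mul g ` A) = emeasure M A"
  shows "distr M borel (engel_mul g) = M"
proof (rule measure_eqI)
  fix A assume "A \<in> sets (distr M borel (engel_mul g))"
  then have A: "A \<in> sets borel" by simp
  have "engel_mul g -` A = engel_mul (- g) ` A"
  proof (intro set_eqI iffI)
    fix x assume "x \<in> engel_mul g -` A"
    then have "engel_mul (- g) (engel_mul g x) \<in> engel_mul (- g) ` A" by blast
    then show "x \<in> engel_mul (- g) ` A" by simp
  qed auto
  moreover have "engel_mul g \<in> measurable M borel"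
    unfolding measurable_cong_sets[OF M refl]
    by (intro borel_measurable_continuous_onI continuous_intros)
  ultimately show "emeasure (distr M borel (engel_mul g)) A = emeasure M A"
    using A inv[of A "- g"] sets_eq_imp_space_eq[OF M] by (simp add: emeasure_distr)
qed (simp add: M)

lemma distr_lborel_engel_mul_left: "distr lborel borel (engel_mul g) = lborel"
  by (rule distr_engel_mul_left) (simp_all add: engel_mul_image_lborel)

lemma distr_lborel_uminus: "distr lborel borel (uminus :: 'a::euclidean_space \<Rightarrow> 'a) = lborel"
  using lborel_affine[of "-1" "0 :: 'a"]
  by (simp add: density_1 one_ennreal_def[symmetric])

text \<open>Inversion is \<open>uminus\<close>, which preserves Lebesgue measure and reverses
  products, so conjugating a left translation by it yields a right translation. Right translations
  matter because they are the flows of left-invariant fields.\<close>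

lemma distr_lborel_engel_mul_right: "distr lborel borel (\<lambda>p. engel_mul p g) = lborel"
proof -
  have "distr lborel borel (\<lambda>p. engel_mul p g)
      = distr (distr (distr lborel borel uminus) borel (engel_mul (- g))) borel uminus"
    by (simp add: distr_distr o_def engel_mul_inverse)
  then show ?thesis by (simp add: distr_lborel_uminus distr_lborel_engel_mul_left)
qed

lemma nn_integral_lborel_engel_mul_right:
  "f \<in> borel_measurable borel \<Longrightarrow> (\<integral>\<^sup>+ p. f (engel_mul p g) \<partial>lborel) = (\<integral>\<^sup>+ p. f p \<partial>lborel)"
  using nn_integral_distr[of "\<lambda>p. engel_mul p g" lborel borel f]
  by (simp add: distr_lborel_engel_mul_right)

lemma nn_integral_lborel_uminus:
  fixes f :: "'a::euclidean_space \<Rightarrow> ennreal"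
  shows "f \<in> borel_measurable borel \<Longrightarrow> (\<integral>\<^sup>+ p. f (- p) \<partial>lborel) = (\<integral>\<^sup>+ p. f p \<partial>lborel)"
  using nn_integral_distr[of "uminus" lborel borel f]
  by (simp add: distr_lborel_uminus)

lemma integral_lborel_engel_mul_right:
  fixes f :: "real^4 \<Rightarrow> real"
  shows "f \<in> borel_measurable borel \<Longrightarrow> (\<integral>p. f (engel_mul p g) \<partial>lborel) = (\<integral>p. f p \<partial>lborel)"
  using integral_distr[of "\<lambda>p. engel_mul p g" lborel borel f]
  by (simp add: distr_lborel_engel_mul_right)

lemma AE_lborel_engel_mul_right:
  assumes "AE p in lborel. P p"
  shows "AE p in lborel. P (engel_mul p g)"
proof (rule AE_distrD[of "\<lambda>p. engel_mul p g" lborel borel])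
  show "AE p in distr lborel borel (\<lambda>p. engel_mul p g). P p"
    unfolding distr_lborel_engel_mul_right by (fact assms)
qed simp

text \<open>Integrating \<open>f x * g (y x)\<close> in both orders and using the invariance of both measures
  (Lebesgue measure is also invariant under right translations and inversion) gives
  \<open>\<mu> f * lborel g = \<mu> g * lborel f\<close>.\<close>

lemma haar_measure_eq:
  assumes "haar_measure \<mu>"
  obtains c where "c > 0" "\<mu> = density lborel (\<lambda>_. ennreal c)"
proof -
  have s [measurable_cong]: "sets \<mu> = sets borel"
    and inv: "A \<in> sets borel \<Longrightarrow> emeasure \<mu> (engel_mul g ` A) = emeasure \<mu> A"
    and cpt: "compact K \<Longrightarrow> emeasure \<mu> K < \<infinity>"
    and op: "open U \<Longrightarrow> U \<noteq> {} \<Longrightarrow> emeasure \<mu> U > 0" for A g K U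
    using assms by (auto simp: haar_measure_def)
  have "sigma_finite_measure \<mu>"
  proof
    show "\<exists>A. countable A \<and> A \<subseteq> sets \<mu> \<and> \<Union> A = space \<mu> \<and> (\<forall>a\<in>A. emeasure \<mu> a \<noteq> \<infinity>)"
    proof (intro exI conjI ballI)
      show "\<Union> (range (\<lambda>n::nat. cball 0 (real n))) = space \<mu>"
        using sets_eq_imp_space_eq[OF s] by (auto intro: real_arch_simple)
      show "emeasure \<mu> a \<noteq> \<infinity>" if "a \<in> range (\<lambda>n::nat. cball 0 (real n))" for a
        using cpt[of a] that by auto
    qed (auto simp: s)
  qed
  then interpret M: sigma_finite_measure \<mu> .
  interpret MP: pair_sigma_finite \<mu> "lborel :: (real^4) measure" ..
  have left: "(\<integral>\<^sup>+ p. f (engel_mul g p) \<partial>\<mu>) = (\<integral>\<^sup>+ p. f p \<partial>\<mu>)"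
    if "f \<in> borel_measurable borel" for f g
  proof -
    have "engel_mul g \<in> measurable \<mu> borel"
      unfolding measurable_cong_sets[OF s refl]
      by (intro borel_measurable_continuous_onI continuous_intros)
    from nn_integral_distr[OF this, of f] that show ?thesis
      by (simp add: distr_engel_mul_left[OF s inv])
  qed
  have *: "(\<integral>\<^sup>+ x. f x \<partial>\<mu>) * (\<integral>\<^sup>+ y. g y \<partial>lborel) = (\<integral>\<^sup>+ x. g x \<partial>\<mu>) * (\<integral>\<^sup>+ y. f y \<partial>lborel)"
    if [measurable]: "f \<in> borel_measurable borel" "g \<in> borel_measurable borel" for f g :: "real^4 \<Rightarrow> ennreal"
  proof -
    have "(\<integral>\<^sup>+ x. f x \<partial>\<mu>) * (\<integral>\<^sup>+ y. g y \<partial>lborel) = (\<integral>\<^sup>+ x. (\<integral>\<^sup>+ y. f x * g y \<partial>lborel) \<partial>\<mu>)"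
      by (simp add: nn_integral_cmult nn_integral_multc)
    also have "\<dots> = (\<integral>\<^sup>+ x. (\<integral>\<^sup>+ y. f x * g (engel_mul y x) \<partial>lborel) \<partial>\<mu>)"
      by (simp add: nn_integral_lborel_engel_mul_right[of "\<lambda>y. f x * g y" for x])
    also have "\<dots> = (\<integral>\<^sup>+ y. (\<integral>\<^sup>+ x. f x * g (engel_mul y x) \<partial>\<mu>) \<partial>lborel)"
      by (rule MP.Fubini'[symmetric]) simp
    also have "\<dots> = (\<integral>\<^sup>+ y. (\<integral>\<^sup>+ x. f (engel_mul (- y) x) * g x \<partial>\<mu>) \<partial>lborel)"
      using left[of "\<lambda>x. f (engel_mul (- y) x) * g x" y for y] by simp
    also have "\<dots> = (\<integral>\<^sup>+ x. (\<integral>\<^sup>+ y. f (engel_mul (- y) x) * g x \<partial>lborel) \<partial>\<mu>)"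
      by (rule MP.Fubini') simp
    also have "\<dots> = (\<integral>\<^sup>+ x. (\<integral>\<^sup>+ y. f y * g x \<partial>lborel) \<partial>\<mu>)"
      using nn_integral_lborel_uminus[of "\<lambda>y. f (engel_mul y x) * g x" for x]
        nn_integral_lborel_engel_mul_right[of "\<lambda>y. f y * g x" for x] by simp
    also have "\<dots> = (\<integral>\<^sup>+ x. g x \<partial>\<mu>) * (\<integral>\<^sup>+ y. f y \<partial>lborel)"
      by (simp add: nn_integral_cmult nn_integral_multc mult.commute)
    finally show ?thesis .
  qed
  \<comment> \<open>The unit cube has Lebesgue measure 1, so testing \<open>*\<close> against its
    indicator identifies the density as the \<open>\<mu>\<close>-measure of the cube. This is
    positive because the cube contains an open box, and finite by compactness.\<close>
  define B :: "(real^4) set" where "B = cbox 0 One"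
  have B: "emeasure lborel B = 1" "compact B" by (simp_all add: B_def emeasure_lborel_cbox_eq)
  have "emeasure \<mu> B > 0"
  proof -
    have "box 0 (One :: real^4) \<noteq> {}" by (simp add: box_ne_empty)
    then have "0 < emeasure \<mu> (box 0 One)" using op open_box by blast
    also have "\<dots> \<le> emeasure \<mu> B"
      by (intro emeasure_mono) (simp_all add: B_def s box_subset_cbox)
    finally show ?thesis .
  qed
  then obtain c where c: "emeasure \<mu> B = ennreal c" "c > 0"
    using cpt[OF B(2)] by (cases "emeasure \<mu> B") auto
  show ?thesis
  proof
    show "\<mu> = density lborel (\<lambda>_. ennreal c)"
    proof (rule measure_eqI)
      fix A assume "A \<in> sets \<mu>"
      then have A: "A \<in> sets borel" by (simp add: s)
      moreover have "B \<in> sets borel" by (simp add: B_def)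
      ultimately show "emeasure \<mu> A = emeasure (density lborel (\<lambda>_. ennreal c)) A"
        using *[of "indicator A" "indicator B"] B c by (simp add: s emeasure_density nn_integral_cmult_indicator)
    qed (simp add: s)
  qed (fact c)
qed

section \<open>Weak monotonicity along left-invariant fields\<close>

lemma continuous_compact_support_integrable:
  fixes f :: "'a::euclidean_space \<Rightarrow> real"
  assumes "continuous_on UNIV f" "bounded S" "\<And>x. x \<notin> S \<Longrightarrow> f x = 0"
  shows "integrable lborel f"
proof -
  have "integrable lborel (\<lambda>x. indicator (closure S) x *\<^sub>R f x)"
    using assms by (intro borel_integrable_compact) (auto simp: compact_closure intro: continuous_on_subset)
  also have "(\<lambda>x. indicator (closure S) x *\<^sub>R f x) = f"
    using assms(3) closure_subset[of S] by (auto simp: indicator_def fun_eq_iff)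
  finally show ?thesis .
qed

lemma smooth_engel_mul: "smooth (\<lambda>p. engel_mul p g $ i)"
proof -
  have "\<forall>i. smooth (\<lambda>p. engel_mul p g $ i)"
    unfolding forall_4 by (simp add: engel_mul_def) (intro conjI smooth_intros)
  then show ?thesis ..
qed

lemma test_function_engel_mul:
  assumes "test_function \<phi>"
  shows "test_function (\<lambda>p. \<phi> (engel_mul p g))"
proof -
  have "{p. \<phi> (engel_mul p g) \<noteq> 0} \<subseteq> (\<lambda>p. engel_mul p (- g)) ` closure {p. \<phi> p \<noteq> 0}" (is "_ \<subseteq> ?f ` ?K")
  proof
    fix p assume "p \<in> {p. \<phi> (engel_mul p g) \<noteq> 0}"
    then have "engel_mul p g \<in> ?K" using closure_subset by fastforce
    then have "?f (engel_mul p g) \<in> ?f ` ?K" by (rule imageI)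
    then show "p \<in> ?f ` ?K" by simp
  qed
  moreover have "compact (?f ` ?K)"
    using assms by (intro compact_continuous_image continuous_intros) (simp add: test_function_def)
  ultimately have "bounded {p. \<phi> (engel_mul p g) \<noteq> 0}"
    using compact_imp_bounded bounded_subset by blast
  then show ?thesis
    using assms smooth_compose[OF _ smooth_engel_mul] by (simp add: test_function_iff)
qed

lemma left_inv_deriv_frechet:
  assumes "test_function \<phi>"
  shows "left_inv_deriv X \<phi> p = frechet_derivative \<phi> (at p) (engel_field X p)"
  using assms smooth_has_derivative
  by (intro left_inv_deriv_eq) (auto simp: test_function_iff differentiable_def)

lemma left_inv_deriv_linear:
  assumes "test_function \<phi>"
  shows "left_inv_deriv (a *\<^sub>R X + b *\<^sub>R Y) \<phi> p = a * left_inv_deriv X \<phi> p + b * left_inv_deriv Y \<phi> p"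
proof -
  have "linear (frechet_derivative \<phi> (at p))"
    using assms smooth_linear_frechet_derivative by (simp add: test_function_iff)
  moreover have "engel_field (a *\<^sub>R X + b *\<^sub>R Y) p = a *\<^sub>R engel_field X p + b *\<^sub>R engel_field Y p"
    by (simp add: engel_field_eq vec_eq_iff forall_4 field_simps)
  ultimately show ?thesis
    using assms by (simp add: left_inv_deriv_frechet linear_add linear_cmul)
qed

lemma continuous_left_inv_deriv:
  assumes "test_function \<phi>"
  shows "continuous_on S (left_inv_deriv X \<phi>)"
proof -
  have eq: "left_inv_deriv X \<phi> = (\<lambda>p. \<Sum>i\<in>UNIV. engel_field X p $ i * frechet_derivative \<phi> (at p) (axis i 1))"
  proof
    fix p
    have l: "linear (frechet_derivative \<phi> (at p))"
      using assms smooth_linear_frechet_derivative by (simp add: test_function_iff)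
    from linear_sum[OF this, of "\<lambda>i. engel_field X p $ i *\<^sub>R axis i 1" UNIV]
    show "left_inv_deriv X \<phi> p = (\<Sum>i\<in>UNIV. engel_field X p $ i * frechet_derivative \<phi> (at p) (axis i 1))"
      using basis_expansion[of "engel_field X p"] linear_cmul[OF l]
      by (simp add: scalar_mult_eq_scaleR left_inv_deriv_frechet[OF assms])
  qed
  have "continuous_on S (\<lambda>p. frechet_derivative \<phi> (at p) v)" for v
    using assms by (simp add: test_function_iff smooth_continuous smooth_frechet_derivative)
  moreover have "continuous_on S (engel_field X)"
    unfolding engel_field_eq[abs_def]
    by (intro continuous_intros bounded_bilinear.continuous_on[OF bounded_bilinear_engel_bracket])
  ultimately show ?thesis
    unfolding eq by (intro continuous_intros)
qed

lemma left_inv_deriv_outside: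
  assumes "test_function \<phi>" "p \<notin> closure {p. \<phi> p \<noteq> 0}"
  shows "left_inv_deriv X \<phi> p = 0"
proof -
  have "((\<lambda>p. 0) has_derivative (\<lambda>v. 0)) (at p)" by simp
  then have "(\<phi> has_derivative (\<lambda>v. 0)) (at p)"
    by (rule has_derivative_transform_within_open[where s = "- closure {p. \<phi> p \<noteq> 0}"])
       (use assms(2) closure_subset[of "{p. \<phi> p \<noteq> 0}"] in auto)
  then have "frechet_derivative \<phi> (at p) = (\<lambda>v. 0)"
    using frechet_derivative_at by metis
  then show ?thesis by (simp add: left_inv_deriv_frechet[OF assms(1)])
qed

lemma integrable_left_inv_deriv:
  assumes "test_function \<phi>"
  shows "integrable lborel (left_inv_deriv X \<phi>)"
  using assms left_inv_deriv_outside
  by (intro continuous_compact_support_integrable[of _ "closure {p. \<phi> p \<noteq> 0}"] continuous_left_inv_deriv)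
     (auto simp: test_function_iff)

text \<open>By the one-parameter law, the derivative at time \<open>t\<close> is the derivative at
  time 0 from the point reached at time \<open>t\<close>.\<close>

lemma has_real_derivative_flow:
  assumes "test_function \<phi>"
  shows "((\<lambda>t. \<phi> (engel_mul p (t *\<^sub>R X))) has_real_derivative
    left_inv_deriv X \<phi> (engel_mul p (t *\<^sub>R X))) (at t)"
proof -
  have 0: "((\<lambda>t. \<phi> (engel_mul q (t *\<^sub>R X))) has_real_derivative left_inv_deriv X \<phi> q) (at 0)" for q
  proof -
    have "(\<phi> has_derivative frechet_derivative \<phi> (at q)) (at (engel_mul q (engel_exp (0 *\<^sub>R X))))"
      using assms smooth_has_derivative by (simp add: test_function_iff engel_exp_def engel_mul_zero)
    from has_derivative_compose[OF has_vector_derivative_engel_field[unfolded has_vector_derivative_def] this]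
    have "((\<lambda>t. \<phi> (engel_mul q (t *\<^sub>R X))) has_derivative
        (\<lambda>h. frechet_derivative \<phi> (at q) (h *\<^sub>R engel_field X q))) (at 0)"
      by (simp add: engel_exp_def)
    moreover have "linear (frechet_derivative \<phi> (at q))"
      using assms smooth_linear_frechet_derivative by (simp add: test_function_iff)
    ultimately show ?thesis
      by (simp add: has_field_derivative_def linear_cmul left_inv_deriv_frechet[OF assms] mult_commute_abs)
  qed
  have "engel_mul (engel_mul p (t *\<^sub>R X)) (h *\<^sub>R X) = engel_mul p ((h + t) *\<^sub>R X)" for h
    using engel_exp_one_parameter[of t h X] by (simp add: engel_mul_assoc engel_exp_def add.commute)
  with 0[of "engel_mul p (t *\<^sub>R X)"]
  have "((\<lambda>h. \<phi> (engel_mul p ((h + t) *\<^sub>R X))) has_real_derivative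
      left_inv_deriv X \<phi> (engel_mul p (t *\<^sub>R X))) (at 0)"
    by simp
  from DERIV_shift[THEN iffD2, OF this] show ?thesis by simp
qed

text \<open>The condition \<open>X 1\<^sub>E \<ge> 0\<close> of the paper, for Borel sets and Lebesgue measure.\<close>

definition monotone_dirs :: "(real^4) set \<Rightarrow> (real^4) set" where
  "monotone_dirs E = {X. \<forall>\<phi>. test_function \<phi> \<and> (\<forall>p. \<phi> p \<ge> 0) \<longrightarrow>
     (\<integral>p. indicator E p * left_inv_deriv X \<phi> p \<partial>lborel) \<le> 0}"

lemma integral_left_inv_deriv_linear:
  assumes E: "E \<in> sets borel" and "test_function \<phi>"
  shows "(\<integral>p. indicator E p * left_inv_deriv (a *\<^sub>R X + b *\<^sub>R Y) \<phi> p \<partial>lborel)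
    = a * (\<integral>p. indicator E p * left_inv_deriv X \<phi> p \<partial>lborel)
      + b * (\<integral>p. indicator E p * left_inv_deriv Y \<phi> p \<partial>lborel)"
proof -
  have "integrable lborel (\<lambda>p. indicator E p * left_inv_deriv X \<phi> p)" for X
    using integrable_mult_indicator[OF _ integrable_left_inv_deriv[OF assms(2)], of E] E by simp
  then show ?thesis
    by (simp add: left_inv_deriv_linear[OF assms(2)] distrib_left mult.left_commute[of "indicator E p" for p])
qed

lemma monotone_dirs_cone:
  assumes "E \<in> sets borel" "X \<in> monotone_dirs E" "Y \<in> monotone_dirs E" "a \<ge> 0" "b \<ge> 0"
  shows "a *\<^sub>R X + b *\<^sub>R Y \<in> monotone_dirs E"
  using assms
  by (auto simp: monotone_dirs_def integral_left_inv_deriv_linear intro!: add_nonpos_nonpos mult_nonneg_nonpos)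

lemma quadratic_nonpos_imp:
  fixes a b c :: real
  assumes "\<And>s. a + s * b + s\<^sup>2 * c \<le> 0"
  shows "c \<le> 0"
proof (rule ccontr)
  assume "\<not> c \<le> 0"
  \<comment> \<open>With this choice
    \<open>s\<^sup>2 * c = s * (\<bar>a\<bar> + \<bar>b\<bar> + c)\<close>, which beats the
    lower-order terms because \<open>s \<ge> 1\<close>.\<close>
  define s where "s = (\<bar>a\<bar> + \<bar>b\<bar>) / c + 1"
  have s: "s \<ge> 1" "s * c = \<bar>a\<bar> + \<bar>b\<bar> + c" using \<open>\<not> c \<le> 0\<close> by (simp_all add: s_def field_simps)
  have "s * (s * c) = s * \<bar>a\<bar> + s * \<bar>b\<bar> + s * c" by (subst s(2)) (simp add: distrib_left)
  moreover have "s\<^sup>2 * c = s * (s * c)" by (simp add: power2_eq_square)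
  moreover have "s * \<bar>a\<bar> \<ge> \<bar>a\<bar>" "s * b \<ge> - (s * \<bar>b\<bar>)"
    using s mult_right_mono[of 1 s "\<bar>a\<bar>"] mult_left_mono[of "- \<bar>b\<bar>" b s] by auto
  moreover have "s * c > 0" using s \<open>\<not> c \<le> 0\<close> by simp
  ultimately show False using assms[of s] by linarith
qed

text \<open>For a fixed test function the integral is linear in the direction, hence a quadratic
  polynomial in \<open>s\<close>, and its leading coefficient cannot be positive. This takes the
  place of dividing by \<open>s\<^sup>2\<close> and passing to the limit in a closed cone.\<close>

lemma monotone_dirs_leading:
  assumes E: "E \<in> sets borel" and "\<And>s. X + s *\<^sub>R Y + s\<^sup>2 *\<^sub>R Z \<in> monotone_dirs E"
  shows "Z \<in> monotone_dirs E"
  unfolding monotone_dirs_def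
proof (intro CollectI allI impI)
  fix \<phi> assume \<phi>: "test_function \<phi> \<and> (\<forall>p. \<phi> p \<ge> 0)"
  define I where "I X = (\<integral>p. indicator E p * left_inv_deriv X \<phi> p \<partial>lborel)" for X
  have lin: "I (a *\<^sub>R X + b *\<^sub>R Y) = a * I X + b * I Y" for a b X Y
    using integral_left_inv_deriv_linear[OF E] \<phi> by (simp add: I_def)
  have "I X + s * I Y + s\<^sup>2 * I Z \<le> 0" for s
    using assms(2)[of s] \<phi> lin[of 1 "X + s *\<^sub>R Y" "s\<^sup>2" Z] lin[of 1 X s Y]
    by (auto simp: monotone_dirs_def I_def)
  from quadratic_nonpos_imp[OF this] show "I Z \<le> 0" .
qed

section \<open>From the weak inequality to monotonicity along flows\<close>

definition flow_monotone :: "(real^4) set \<Rightarrow> real^4 \<Rightarrow> bool" where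
  "flow_monotone E g \<longleftrightarrow> (AE p in lborel. p \<in> E \<longrightarrow> engel_mul p g \<in> E)"

text \<open>The derivative in \<open>s\<close> of the integral of
  \<open>\<phi> (engel_mul p (s *\<^sub>R X))\<close> over \<open>E\<close> should be the integral
  of the \<open>X\<close>-derivative of a translated test function, which is nonpositive. The
  fundamental theorem of calculus on each flow line and Fubini replace differentiation under the
  integral.\<close>

lemma flow_integral_mono:
  assumes E: "E \<in> sets borel" and X: "X \<in> monotone_dirs E"
    and \<phi>: "test_function \<phi>" "\<And>p. \<phi> p \<ge> 0" and t: "t \<ge> 0"
  shows "(\<integral>p. indicator E p * \<phi> (engel_mul p (t *\<^sub>R X)) \<partial>lborel) \<le> (\<integral>p. indicator E p * \<phi> p \<partial>lborel)"
proof -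
  define H where "H p s = indicator E p * (left_inv_deriv X \<phi> (engel_mul p (s *\<^sub>R X)) * indicator {0..t} s)" for p s
  have test: "test_function (\<lambda>p. \<phi> (engel_mul p (s *\<^sub>R X)))" for s
    by (rule test_function_engel_mul[OF \<phi>(1)])
  have Hp: "(\<integral>s. H p s \<partial>lborel) = indicator E p * \<phi> (engel_mul p (t *\<^sub>R X)) - indicator E p * \<phi> p" for p
  proof -
    have "(\<integral>s. left_inv_deriv X \<phi> (engel_mul p (s *\<^sub>R X)) * indicator {0..t} s \<partial>lborel)
        = \<phi> (engel_mul p (t *\<^sub>R X)) - \<phi> (engel_mul p (0 *\<^sub>R X))"
    proof (rule integral_FTC_Icc_real[OF t])
      fix s
      show "isCont (\<lambda>s. left_inv_deriv X \<phi> (engel_mul p (s *\<^sub>R X))) s"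
        by (rule continuous_on_interior[of UNIV])
           (auto intro!: continuous_intros continuous_on_compose2[OF continuous_left_inv_deriv[OF \<phi>(1), of UNIV]])
    qed (rule has_real_derivative_flow[OF \<phi>(1)])
    then show ?thesis by (simp add: H_def engel_mul_zero right_diff_distrib)
  qed
  \<comment> \<open>Right translation by an element of the subgroup of \<open>X\<close> commutes
    with differentiation along \<open>X\<close>, so the hypothesis applies to the translated test
    function.\<close>
  have Hs: "(\<integral>p. H p s \<partial>lborel) \<le> 0" for s
  proof -
    have "left_inv_deriv X (\<lambda>p. \<phi> (engel_mul p (s *\<^sub>R X))) p = left_inv_deriv X \<phi> (engel_mul p (s *\<^sub>R X))" for p
    proof -
      have "engel_mul (r *\<^sub>R X) (s *\<^sub>R X) = engel_mul (s *\<^sub>R X) (r *\<^sub>R X)" for r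
        by (simp flip: engel_exp_one_parameter[unfolded engel_exp_def] add: add.commute)
      then show ?thesis by (simp add: left_inv_deriv_def engel_exp_def engel_mul_assoc)
    qed
    then have "(\<integral>p. indicator E p * left_inv_deriv X \<phi> (engel_mul p (s *\<^sub>R X)) \<partial>lborel) \<le> 0"
      using X[unfolded monotone_dirs_def, THEN CollectD, rule_format,
          of "\<lambda>p. \<phi> (engel_mul p (s *\<^sub>R X))"] test[of s] \<phi>(2) by simp
    moreover have "(\<integral>p. H p s \<partial>lborel)
        = (\<integral>p. indicator E p * left_inv_deriv X \<phi> (engel_mul p (s *\<^sub>R X)) \<partial>lborel) * indicator {0..t} s"
      unfolding H_def mult.assoc[symmetric] by simp
    ultimately show ?thesis by (simp add: mult_nonpos_nonneg)
  qed
  have int: "integrable (lborel \<Otimes>\<^sub>M lborel) (case_prod H)"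
  proof -
    \<comment> \<open>\<open>K\<close> holds every \<open>(p, s)\<close> with \<open>s\<close> in
      \<open>{0..t}\<close> whose flow point lies in the support of \<open>\<phi>\<close>. It is
      compact as a continuous image, which makes the integrand integrable for Fubini.\<close>
    define K where "K = (\<lambda>(p, s). (engel_mul p (- (s *\<^sub>R X)), s)) ` (closure {p. \<phi> p \<noteq> 0} \<times> {0..t})"
    have "compact K"
      unfolding K_def case_prod_unfold using \<phi>(1)
      by (intro compact_continuous_image continuous_intros compact_Times) (auto simp: test_function_def)
    then have "integrable lborel (\<lambda>z. indicator K z *\<^sub>R left_inv_deriv X \<phi> (engel_mul (fst z) (snd z *\<^sub>R X)))"
      by (intro borel_integrable_compact continuous_on_compose2[OF continuous_left_inv_deriv[OF \<phi>(1), of UNIV]]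
          continuous_intros) auto
    from integrable_mult_indicator[OF _ this, of "E \<times> {0..t}"] E
    have "integrable lborel (\<lambda>z. indicator (E \<times> {0..t}) z *\<^sub>R
        (indicator K z *\<^sub>R left_inv_deriv X \<phi> (engel_mul (fst z) (snd z *\<^sub>R X))))"
      by (simp add: borel_Times)
    also have "(\<lambda>z. indicator (E \<times> {0..t}) z *\<^sub>R
        (indicator K z *\<^sub>R left_inv_deriv X \<phi> (engel_mul (fst z) (snd z *\<^sub>R X)))) = case_prod H"
    proof (intro ext, clarify)
      fix p s
      have "(p, s) \<in> K" if "s \<in> {0..t}" "left_inv_deriv X \<phi> (engel_mul p (s *\<^sub>R X)) \<noteq> 0"
      proof -
        have "engel_mul p (s *\<^sub>R X) \<in> closure {p. \<phi> p \<noteq> 0}"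
          using left_inv_deriv_outside[OF \<phi>(1)] that by blast
        then have "(engel_mul (engel_mul p (s *\<^sub>R X)) (- (s *\<^sub>R X)), s) \<in> K"
          using that(1) by (force simp: K_def)
        then show ?thesis by simp
      qed
      then show "indicator (E \<times> {0..t}) (p, s) *\<^sub>R (indicator K (p, s) *\<^sub>R
          left_inv_deriv X \<phi> (engel_mul (fst (p, s)) (snd (p, s) *\<^sub>R X))) = H p s"
        by (auto simp: H_def indicator_def)
    qed
    finally show ?thesis by (simp add: lborel_prod)
  qed
  have "(\<integral>p. (\<integral>s. H p s \<partial>lborel) \<partial>lborel) = (\<integral>s. (\<integral>p. H p s \<partial>lborel) \<partial>lborel)"
    by (rule lborel_pair.Fubini_integral[OF int, symmetric])
  moreover have "\<dots> \<le> 0" using integral_nonneg_AE[of "\<lambda>s. - (\<integral>p. H p s \<partial>lborel)" lborel] Hs by simp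
  moreover have "(\<integral>p. (\<integral>s. H p s \<partial>lborel) \<partial>lborel)
      = (\<integral>p. indicator E p * \<phi> (engel_mul p (t *\<^sub>R X)) \<partial>lborel) - (\<integral>p. indicator E p * \<phi> p \<partial>lborel)"
  proof -
    have "integrable lborel (\<lambda>p. indicator E p * \<psi> p)" if "test_function \<psi>" for \<psi>
    proof -
      have "integrable lborel \<psi>"
        using that smooth_continuous[of \<psi> UNIV]
        by (intro continuous_compact_support_integrable[of \<psi> "{p. \<psi> p \<noteq> 0}"]) (auto simp: test_function_iff)
      from integrable_mult_indicator[OF _ this, of E] show ?thesis using E by simp
    qed
    from this[OF test] this[OF \<phi>(1)] show ?thesis unfolding Hp by simp
  qed
  ultimately show ?thesis by simp
qed

text \<open>The sets where test functions with values in [0, 1] are nonzero include all balls and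
  are closed under finite unions, and \<open>A\<close> has no more mass in them than
  \<open>B\<close>. A compact subset of \<open>A - B\<close> of positive measure would have such a
  neighbourhood with excess smaller than its own measure, a contradiction; inner regularity does the
  rest.\<close>

lemma AE_of_test_functions:
  assumes A: "A \<in> sets borel" and B: "B \<in> sets borel"
    and le: "\<And>\<phi>. test_function \<phi> \<Longrightarrow> (\<And>p. \<phi> p \<ge> 0) \<Longrightarrow>
      (\<integral>p. indicator A p * \<phi> p \<partial>lborel) \<le> (\<integral>p. indicator B p * \<phi> p \<partial>lborel)"
  shows "AE p in lborel. p \<in> A \<longrightarrow> p \<in> B"
proof -
  define \<V> where "\<V> = {V. \<exists>\<psi>. test_function \<psi> \<and> (\<forall>p. 0 \<le> \<psi> p \<and> \<psi> p \<le> 1) \<and> V = {p. \<psi> p \<noteq> 0}}"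
  have ball: "ball c r \<in> \<V>" if r: "r > 0" for c r
  proof -
    obtain \<psi> where "test_function \<psi>" "\<And>p. 0 \<le> \<psi> p" "\<And>p. \<psi> p \<le> 1" "{p. \<psi> p \<noteq> 0} = ball c r"
      using test_function_ball[OF r] by blast
    then show ?thesis unfolding \<V>_def by (auto intro!: exI[of _ \<psi>])
  qed
  have empty: "{} \<in> \<V>"
    unfolding \<V>_def by (auto intro!: exI[of _ "\<lambda>_. 0"] simp: test_function_iff smooth_const)
  have un: "V \<union> W \<in> \<V>" if VW: "V \<in> \<V>" "W \<in> \<V>" for V W
  proof -
    obtain \<psi> \<omega> where *: "test_function \<psi>" "\<And>p. 0 \<le> \<psi> p" "\<And>p. \<psi> p \<le> 1" "V = {p. \<psi> p \<noteq> 0}"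
      "test_function \<omega>" "\<And>p. 0 \<le> \<omega> p" "\<And>p. \<omega> p \<le> 1" "W = {p. \<omega> p \<noteq> 0}"
      using VW unfolding \<V>_def by blast
    \<comment> \<open>This is \<open>1 - (1 - \<psi> p) * (1 - \<omega> p)\<close>: it stays in
      [0, 1] and vanishes only where both functions do.\<close>
    let ?\<chi> = "\<lambda>p. \<psi> p + (1 - \<psi> p) * \<omega> p"
    have nz: "?\<chi> p = 0 \<longleftrightarrow> \<psi> p = 0 \<and> \<omega> p = 0" for p
      using *(2,3,6)[of p] by (auto simp: add_nonneg_eq_0_iff)
    then have supp: "{p. ?\<chi> p \<noteq> 0} = V \<union> W" unfolding * by blast
    have "bounded (V \<union> W)" "smooth ?\<chi>"
      using *(1,5) unfolding *(4,8) test_function_iff by (auto intro!: smooth_intros)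
    moreover have "0 \<le> ?\<chi> p" "?\<chi> p \<le> 1" for p
      using *(2,3,6,7)[of p] mult_left_mono[of "\<omega> p" 1 "1 - \<psi> p"] by auto
    ultimately show ?thesis
      unfolding \<V>_def using supp by (auto simp: test_function_iff intro!: exI[of _ ?\<chi>])
  qed
  have V: "bounded V \<and> open V \<and> measure lborel (A \<inter> V) \<le> measure lborel (B \<inter> V)" if V: "V \<in> \<V>" for V
  proof -
    obtain \<psi> where \<psi>: "test_function \<psi>" "\<And>p. 0 \<le> \<psi> p" "\<And>p. \<psi> p \<le> 1" "V = {p. \<psi> p \<noteq> 0}"
      using V unfolding \<V>_def by blast
    have s: "smooth \<psi>" and b: "bounded V" using \<psi> by (auto simp: test_function_iff)
    have o: "open V"
      unfolding \<psi>(4) by (intro open_Collect_neq smooth_continuous[OF s] continuous_intros)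
    \<comment> \<open>These test functions increase to the indicator of \<open>V\<close>, so
      dominated convergence turns the hypothesis on integrals into a comparison of measures.\<close>
    define \<phi> where "\<phi> n p = 1 - (1 - \<psi> p) ^ n" for n :: nat and p
    have \<phi>: "0 \<le> \<phi> n p" "\<phi> n p \<le> indicator V p" for n p
      using \<psi>(2,3)[of p] by (auto simp: \<phi>_def \<psi>(4) indicator_def power_le_one)
    have t: "test_function (\<phi> n)" for n
    proof -
      have "{p. \<phi> n p \<noteq> 0} \<subseteq> V" by (auto simp: \<phi>_def \<psi>(4))
      then show ?thesis
        using b bounded_subset unfolding test_function_iff \<phi>_def by (auto intro!: smooth_intros s)
    qed
    have lim: "(\<lambda>n. \<phi> n p) \<longlonglongrightarrow> indicator V p" for p
    proof (cases "p \<in> V")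
      case True
      then have "(\<lambda>n. (1 - \<psi> p) ^ n) \<longlonglongrightarrow> 0"
        using \<psi>(2,3)[of p] by (intro LIMSEQ_power_zero) (auto simp: \<psi>(4))
      from tendsto_diff[OF tendsto_const[of 1] this] show ?thesis using True by (simp add: \<phi>_def)
    qed (simp add: \<phi>_def \<psi>(4))
    have conv: "(\<lambda>n. \<integral>p. indicator S p * \<phi> n p \<partial>lborel) \<longlonglongrightarrow> measure lborel (S \<inter> V)"
      if S: "S \<in> sets borel" for S
    proof -
      have [measurable]: "V \<in> sets borel" "S \<in> sets borel" "\<phi> n \<in> borel_measurable borel" for n
        using o S t by (auto simp: test_function_iff intro!: borel_measurable_continuous_onI smooth_continuous)
      have "(\<lambda>n. \<integral>p. indicator S p * \<phi> n p \<partial>lborel) \<longlonglongrightarrow> (\<integral>p. indicator S p * indicator V p \<partial>lborel)"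
      proof (rule integral_dominated_convergence[where w = "indicator V"])
        show "integrable lborel (indicator V :: _ \<Rightarrow> real)"
          using emeasure_bounded_finite[OF b] o by (intro integrable_real_indicator) auto
        show "AE p in lborel. (\<lambda>n. indicator S p * \<phi> n p) \<longlonglongrightarrow> indicator S p * indicator V p"
          using lim by (intro AE_I2 tendsto_mult tendsto_const)
        show "AE p in lborel. norm (indicator S p * \<phi> n p) \<le> indicator V p" for n
          using \<phi>[of n] by (intro AE_I2) (auto simp: indicator_times_eq_if split: split_indicator)
      qed simp_all
      then show ?thesis by (simp flip: indicator_inter_arith)
    qed
    have "measure lborel (A \<inter> V) \<le> measure lborel (B \<inter> V)"
      using le[OF t \<phi>(1)] by (intro LIMSEQ_le[OF conv[OF A] conv[OF B]]) auto
    then show ?thesis using o b by simp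
  qed
  have null: "emeasure lborel T = 0" if T: "compact T" "T \<subseteq> A - B" for T
  proof (rule ccontr)
    assume "emeasure lborel T \<noteq> 0"
    then have m: "measure lborel T > 0"
      using emeasure_compact_finite[OF T(1)] by (simp add: measure_def enn2real_positive_iff zero_less_iff_neq_zero)
    obtain U where U: "open U" "T \<subseteq> U" "emeasure lebesgue (U - T) < ennreal (measure lborel T)"
      using sets_lebesgue_outer_open[OF _ m, of T] T(1) by (metis compact_imp_closed lebesgue_closedin fmeasurableD lmeasurable_compact)
    obtain W where W: "W \<in> \<V>" "T \<subseteq> W" "W \<subseteq> U"
    proof -
      have "\<exists>r>0. ball p r \<subseteq> U" if "p \<in> T" for p
        using U(1,2) that open_contains_ball by blast
      then obtain r where r: "\<And>p. p \<in> T \<Longrightarrow> r p > 0 \<and> ball p (r p) \<subseteq> U" by metis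
      obtain D where D: "D \<subseteq> T" "finite D" "T \<subseteq> (\<Union>p\<in>D. ball p (r p))"
      proof (rule compactE_image[OF T(1), of T "\<lambda>p. ball p (r p)"])
        show "T \<subseteq> (\<Union>p\<in>T. ball p (r p))" using r by force
      qed auto
      have "(\<Union>p\<in>D. ball p (r p)) \<in> \<V>"
        using D(2,1) by (induction D) (auto intro: empty un ball dest: r)
      moreover have "(\<Union>p\<in>D. ball p (r p)) \<subseteq> U" using D(1) r by blast
      ultimately show ?thesis using that D(3) by blast
    qed
    have Wb: "W \<in> sets borel" "emeasure lborel W < \<infinity>"
      using V[OF W(1)] emeasure_bounded_finite by auto
    have fin: "S \<in> fmeasurable lborel" if "S \<in> sets borel" "S \<subseteq> W" for S
      using fmeasurableI2[OF fmeasurableI[of W lborel]] Wb that by auto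
    have "measure lborel T \<le> measure lborel (A \<inter> W)"
      using T W A Wb fin by (intro measure_mono_fmeasurable) (auto intro: borel_compact)
    also have "\<dots> \<le> measure lborel (B \<inter> W)" using V[OF W(1)] by simp
    \<comment> \<open>Since \<open>T\<close> misses \<open>B\<close>, the set
      \<open>B \<inter> W\<close> lies in \<open>U - T\<close>, whose measure is below that of
      \<open>T\<close>.\<close>
    also have "\<dots> < measure lborel T"
    proof -
      have "emeasure lborel (B \<inter> W) \<le> emeasure lborel (U - T)"
        using T W B U Wb by (intro emeasure_mono) (auto simp: sets.Diff borel_compact)
      also have "\<dots> = emeasure lebesgue (U - T)"
        using U(1) T(1) by (simp add: borel_compact sets.Diff)
      also have "\<dots> < ennreal (measure lborel T)" by (fact U(3))
      finally show ?thesis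
        using fin[of "B \<inter> W"] B Wb m by (simp add: emeasure_eq_measure2 ennreal_less_iff)
    qed
    finally show False by simp
  qed
  \<comment> \<open>Cutting with balls makes the measure finite and turns the closed sets of inner
    regularity into compact ones.\<close>
  have "emeasure lborel ((A - B) \<inter> cball 0 (real k)) = 0" for k :: nat
  proof (rule ccontr)
    let ?N = "(A - B) \<inter> cball 0 (real k)"
    assume ne: "emeasure lborel ?N \<noteq> 0"
    have N: "?N \<in> sets borel" using A B by simp
    have "emeasure lborel ?N < \<infinity>" by (intro emeasure_bounded_finite) (simp add: bounded_Int)
    then have m: "measure lborel ?N > 0"
      using ne by (simp add: measure_def enn2real_positive_iff zero_less_iff_neq_zero)
    obtain T where T: "closed T" "T \<subseteq> ?N" "emeasure lebesgue (?N - T) < ennreal (measure lborel ?N)"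
    proof (rule sets_lebesgue_inner_closed[OF _ m])
      show "?N \<in> sets lebesgue" using N by simp
    qed
    have "bounded T" by (rule bounded_subset[OF bounded_cball]) (use T(2) in blast)
    with T(1) have "compact T" by (simp add: compact_eq_bounded_closed)
    then have T0: "emeasure lborel T = 0" using null T(2) by blast
    have "emeasure lborel ?N \<le> emeasure lborel (?N - T) + emeasure lborel T"
      using emeasure_subadditive[of "?N - T" lborel T] N T(1,2) by (simp add: Un_absorb2)
    also have "\<dots> < ennreal (measure lborel ?N)" using T N T0 by simp
    also have "\<dots> = emeasure lborel ?N"
      using \<open>emeasure lborel ?N < \<infinity>\<close> by (simp add: emeasure_eq_ennreal_measure)
    finally show False by simp
  qed
  then have "AE p in lborel. p \<notin> (A - B) \<inter> cball 0 (real k)" for k :: nat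
    using A B by (intro AE_not_in null_setsI) auto
  then have "AE p in lborel. \<forall>k::nat. p \<notin> (A - B) \<inter> cball 0 (real k)"
    by (simp only: AE_all_countable) simp
  then show ?thesis
    by eventually_elim (use real_arch_simple in auto)
qed

lemma flow_monotoneI:
  assumes E: "E \<in> sets borel" and X: "X \<in> monotone_dirs E" and t: "t \<ge> 0"
  shows "flow_monotone E (t *\<^sub>R X)"
  unfolding flow_monotone_def
proof -
  have E': "{p. engel_mul p (t *\<^sub>R X) \<in> E} \<in> sets borel"
    using E measurable_sets[of "\<lambda>p. engel_mul p (t *\<^sub>R X)" borel borel E]
    by (simp add: vimage_def)
  have "AE p in lborel. p \<in> E \<longrightarrow> p \<in> {p. engel_mul p (t *\<^sub>R X) \<in> E}"
  proof (rule AE_of_test_functions[OF E E'])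
    fix \<phi> :: "real^4 \<Rightarrow> real" assume \<phi>: "test_function \<phi>" "\<And>p. \<phi> p \<ge> 0"
    \<comment> \<open>Pulling the test function back lets right invariance transfer the translation
      from the function to the set.\<close>
    let ?\<psi> = "\<lambda>p. \<phi> (engel_mul p (- (t *\<^sub>R X)))"
    have m: "\<phi> \<in> borel_measurable borel"
      using \<phi>(1) by (simp add: test_function_iff borel_measurable_continuous_onI smooth_continuous)
    have "(\<integral>p. indicator E p * \<phi> p \<partial>lborel) = (\<integral>p. indicator E p * ?\<psi> (engel_mul p (t *\<^sub>R X)) \<partial>lborel)"
      by simp
    also have "\<dots> \<le> (\<integral>p. indicator E p * ?\<psi> p \<partial>lborel)"
      by (rule flow_integral_mono[OF E X test_function_engel_mul[OF \<phi>(1)] \<phi>(2) t])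
    also have "\<dots> = (\<integral>p. indicator E (engel_mul p (t *\<^sub>R X)) * \<phi> p \<partial>lborel)"
      using integral_lborel_engel_mul_right[of "\<lambda>p. indicator E p * ?\<psi> p" "t *\<^sub>R X"] E m by simp
    also have "\<dots> = (\<integral>p. indicator {p. engel_mul p (t *\<^sub>R X) \<in> E} p * \<phi> p \<partial>lborel)"
      by (simp add: indicator_def)
    finally show "(\<integral>p. indicator E p * \<phi> p \<partial>lborel)
      \<le> (\<integral>p. indicator {p. engel_mul p (t *\<^sub>R X) \<in> E} p * \<phi> p \<partial>lborel)" .
  qed
  then show "AE p in lborel. p \<in> E \<longrightarrow> engel_mul p (t *\<^sub>R X) \<in> E" by simp
qed



text \<open>Right translation by \<open>g\<close> carries the field of \<open>X\<close> to that of
  \<open>X'\<close>, and the two flow hypotheses make \<open>E\<close> invariant under it up to a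
  null set. A change of variables then moves the inequality from \<open>X\<close> to
  \<open>X'\<close>, which is \<open>Ad (- g) X\<close>.\<close>

lemma monotone_dirs_conjugate:
  assumes E: "E \<in> sets borel" and g: "flow_monotone E g" "flow_monotone E (- g)"
    and X: "X \<in> monotone_dirs E"
    and conj: "\<And>t. engel_mul (- g) (engel_mul (t *\<^sub>R X) g) = t *\<^sub>R X'"
  shows "X' \<in> monotone_dirs E"
  unfolding monotone_dirs_def
proof (intro CollectI allI impI)
  fix \<phi> assume \<phi>: "test_function \<phi> \<and> (\<forall>p. \<phi> p \<ge> 0)"
  have "engel_mul (t *\<^sub>R X) g = engel_mul g (t *\<^sub>R X')" for t
    using conj[of t] by (metis engel_mul_cancel(2))
  then have d: "left_inv_deriv X (\<lambda>p. \<phi> (engel_mul p g)) p = left_inv_deriv X' \<phi> (engel_mul p g)" for p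
    by (simp add: left_inv_deriv_def engel_exp_def engel_mul_assoc)
  have "AE p in lborel. engel_mul p g \<in> E \<longrightarrow> engel_mul (engel_mul p g) (- g) \<in> E"
    using AE_lborel_engel_mul_right[OF g(2)[unfolded flow_monotone_def], of g] .
  with g(1)[unfolded flow_monotone_def]
  have inv: "AE p in lborel. engel_mul p g \<in> E \<longleftrightarrow> p \<in> E"
    by eventually_elim auto
  have m [measurable]: "left_inv_deriv X' \<phi> \<in> borel_measurable borel" "E \<in> sets borel"
    using \<phi> E by (auto intro!: borel_measurable_continuous_onI continuous_left_inv_deriv)
  have "(\<integral>p. indicator E p * left_inv_deriv X' \<phi> p \<partial>lborel)
      = (\<integral>p. indicator E (engel_mul p g) * left_inv_deriv X' \<phi> (engel_mul p g) \<partial>lborel)"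
    using integral_lborel_engel_mul_right[of "\<lambda>p. indicator E p * left_inv_deriv X' \<phi> p" g] by simp
  also have "\<dots> = (\<integral>p. indicator E p * left_inv_deriv X (\<lambda>p. \<phi> (engel_mul p g)) p \<partial>lborel)"
    unfolding d
    by (rule integral_cong_AE) (use inv in \<open>auto simp: indicator_def elim: eventually_mono\<close>)
  also have "\<dots> \<le> 0"
    using X[unfolded monotone_dirs_def, THEN CollectD, rule_format, of "\<lambda>p. \<phi> (engel_mul p g)"]
      test_function_engel_mul \<phi> by blast
  finally show "(\<integral>p. indicator E p * left_inv_deriv X' \<phi> p \<partial>lborel) \<le> 0" .
qed

section \<open>Epigraphs of Lipschitz functions\<close>

text \<open>The slope one of this cone becomes the Lipschitz constant 1. The strict inequality makes
  it open, so that Lindelof covers apply to its translates.\<close>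

definition future :: "('a::real_normed_vector \<times> real) set" where
  "future = {v. norm (fst v) < snd v}"

lemma future_add: "v \<in> future \<Longrightarrow> w \<in> future \<Longrightarrow> v + w \<in> future"
  unfolding future_def by (auto intro: le_less_trans[OF norm_triangle_ineq] add_strict_mono)

lemma open_translate_future: "open ((+) x ` (future :: ('a::real_normed_vector \<times> real) set))"
  unfolding future_def by (intro open_translation open_Collect_less continuous_intros)

lemma mem_translate_future: "y \<in> (+) x ` future \<longleftrightarrow> y - x \<in> future"
  by (auto simp: image_iff intro!: bexI[of _ "y - x"])

text \<open>The graph is the image of the hyperplane \<open>snd x = 0\<close> under the Lipschitz
  shear \<open>?f\<close>.\<close>

lemma negligible_graph:
  fixes h :: "'a::euclidean_space \<Rightarrow> real"
  assumes "L-lipschitz_on UNIV h"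
  shows "negligible {x. snd x = h (fst x)}"
proof -
  let ?f = "\<lambda>x. (fst x, h (fst x) + snd x)"
  have "negligible (?f ` {x :: 'a \<times> real. (0, 1) \<bullet> x = 0})"
  proof (rule negligible_locally_Lipschitz_image)
    show "negligible {x :: 'a \<times> real. (0, 1) \<bullet> x = 0}"
      by (rule negligible_hyperplane) (simp add: zero_prod_def)
    fix x :: "'a \<times> real" assume x: "x \<in> {x. (0, 1) \<bullet> x = 0}"
    have "norm (?f y - ?f x) \<le> (1 + L) * norm (y - x)" if "y \<in> {x. (0, 1) \<bullet> x = 0}" for y
    proof -
      have "norm (?f y - ?f x) \<le> norm (fst (y - x)) + \<bar>h (fst y) - h (fst x)\<bar>"
        using x that norm_Pair_le[of "fst y - fst x" "h (fst y) - h (fst x)"]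
        by (simp add: inner_prod_def)
      also have "\<dots> \<le> norm (fst (y - x)) + L * norm (fst (y - x))"
        using lipschitz_onD[OF assms, of "fst y" "fst x"] by (simp add: dist_norm)
      also have "\<dots> \<le> (1 + L) * norm (y - x)"
      proof -
        have "norm (fst (y - x)) \<le> norm (y - x)"
          by (metis norm_fst_le prod.collapse)
        then show ?thesis
          using lipschitz_on_nonneg[OF assms]
          by (simp only: distrib_right mult_1 mult_left_mono add_mono)
      qed
      finally show ?thesis .
    qed
    then show "\<exists>T B. open T \<and> x \<in> T \<and>
        (\<forall>y\<in>{x. (0, 1) \<bullet> x = 0} \<inter> T. norm (?f y - ?f x) \<le> B * norm (y - x))"
      by (intro exI[of _ UNIV] exI[of _ "1 + L"]) auto
  qed simp
  moreover have "{x. snd x = h (fst x)} \<subseteq> ?f ` {x :: 'a \<times> real. (0, 1) \<bullet> x = 0}"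
    by (auto simp: image_iff intro!: bexI[of _ "(a, 0)" for a])
  ultimately show ?thesis using negligible_subset by blast
qed



text \<open>\<open>h a\<close> is the infimum of the fibre over \<open>a\<close>. The fibre is
  nonempty because the cone at a point of \<open>F\<close> meets every vertical line, and bounded
  below because otherwise a point outside \<open>F\<close> would lie in the cone of a point of
  \<open>F\<close>. Points on the graph are left undecided.\<close>

lemma future_closed_epigraph:
  fixes F :: "('a::real_normed_vector \<times> real) set"
  assumes add: "\<And>x v. x \<in> F \<Longrightarrow> v \<in> future \<Longrightarrow> x + v \<in> F" and ne: "F \<noteq> {}" "F \<noteq> UNIV"
  obtains h where "1-lipschitz_on UNIV h" "\<And>a b. b > h a \<Longrightarrow> (a, b) \<in> F"
    "\<And>a b. (a, b) \<in> F \<Longrightarrow> b \<ge> h a"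
proof -
  have up: "(a', b') \<in> F" if "(a, b) \<in> F" "norm (a' - a) < b' - b" for a b a' b'
    using add[OF that(1), of "(a' - a, b' - b)"] that(2) by (simp add: future_def)
  define B where "B a = {b. (a, b) \<in> F}" for a
  obtain a0 b0 where 0: "(a0, b0) \<in> F" using ne(1) by auto
  obtain a1 b1 where 1: "(a1, b1) \<notin> F" using ne(2) by auto
  have B_ne: "B a \<noteq> {}" for a
    using up[OF 0, of a "b0 + norm (a - a0) + 1"] by (auto simp: B_def)
  have "b \<ge> b1 - norm (a1 - a)" if "b \<in> B a" for a b
    using up[of a b a1 b1] 1 that by (force simp: B_def)
  then have bdd: "bdd_below (B a)" for a by (meson bdd_belowI)
  define h where "h a = Inf (B a)" for a
  have le: "h a \<le> b" if "(a, b) \<in> F" for a b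
    unfolding h_def by (rule cInf_lower[OF _ bdd]) (use that in \<open>simp add: B_def\<close>)
  have gr: "(a, b) \<in> F" if b: "b > h a" for a b
  proof -
    obtain c where "c \<in> B a" "c < b"
      using b cInf_lessD[OF B_ne] unfolding h_def by blast
    then show ?thesis using up[of a c a b] by (simp add: B_def)
  qed
  have "h a' \<le> h a + norm (a' - a)" for a a'
  proof (rule field_le_epsilon)
    fix e :: real assume "e > 0"
    then have "(a, h a + e / 2) \<in> F" by (intro gr) simp
    from up[OF this, of a' "h a + norm (a' - a) + e"] \<open>e > 0\<close>
    have "(a', h a + norm (a' - a) + e) \<in> F" by simp
    then show "h a' \<le> h a + norm (a' - a) + e" by (rule le)
  qed
  then have "1-lipschitz_on UNIV h"
    by (intro lipschitz_onI) (auto simp: dist_norm abs_le_iff diff_le_eq add.commute, metis norm_minus_commute)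
  then show ?thesis using that gr le by blast
qed

text \<open>The points from which almost all of the future lies in \<open>F\<close> form a set that is genuinely
  closed under translation by \<open>future\<close> and differs from \<open>F\<close> by a null set.\<close>

lemma future_monotone_epigraph:
  fixes F :: "('a::euclidean_space \<times> real) set"
  assumes mono: "negligible {x \<in> F. \<not> negligible {v \<in> future. x + v \<notin> F}}"
    and ne: "\<not> negligible F" "\<not> negligible (- F)"
  obtains h where "1-lipschitz_on UNIV h"
    "negligible (F - {x. snd x > h (fst x)})" "negligible ({x. snd x > h (fst x)} - F)"
proof -
  define F' where "F' = {x. negligible {v \<in> future. x + v \<notin> F}}"
  have diff: "negligible (F - F')"
    using mono by (rule negligible_subset) (auto simp: F'_def)
  have cone: "negligible ((+) x ` future - F)" if "x \<in> F'" for x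
  proof -
    have "negligible ((+) x ` {v \<in> future. x + v \<notin> F})"
      using that by (intro negligible_translation) (simp add: F'_def)
    then show ?thesis by (rule negligible_subset) auto
  qed
  have add: "x + v \<in> F'" if "x \<in> F'" "v \<in> future" for x v
  proof -
    have "negligible ((+) (- v) ` {w \<in> future. x + w \<notin> F})"
      using that(1) by (intro negligible_translation) (simp add: F'_def)
    moreover have "{w \<in> future. x + v + w \<notin> F} \<subseteq> (+) (- v) ` {w \<in> future. x + w \<notin> F}"
    proof
      fix w assume "w \<in> {w \<in> future. x + v + w \<notin> F}"
      then have "v + w \<in> {w \<in> future. x + w \<notin> F}"
        using future_add[OF that(2), of w] by (simp add: add.assoc)
      then have "- v + (v + w) \<in> (+) (- v) ` {w \<in> future. x + w \<notin> F}" by (rule imageI)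
      then show "w \<in> (+) (- v) ` {w \<in> future. x + w \<notin> F}" by simp
    qed
    ultimately show ?thesis unfolding F'_def using negligible_subset by blast
  qed
  have "F' \<noteq> {}" using ne(1) diff by auto
  \<comment> \<open>The cones with apex \<open>(0, - n)\<close> exhaust the space, so if every point
    were in \<open>F'\<close> then \<open>F\<close> would have full measure.\<close>
  moreover have "F' \<noteq> UNIV"
  proof
    assume U: "F' = UNIV"
    let ?x = "\<lambda>n::nat. (0 :: 'a, - real n)"
    have "negligible (\<Union>n. (+) (?x n) ` future - F)"
      by (rule negligible_countable_Union) (auto intro!: cone simp: U)
    moreover have "- F \<subseteq> (\<Union>n. (+) (?x n) ` future - F)"
    proof
      fix y assume y: "y \<in> - F"
      obtain n :: nat where "norm (fst y) - snd y < real n" using reals_Archimedean2 by blast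
      then have "y \<in> (+) (?x n) ` future"
        unfolding mem_translate_future by (simp add: future_def)
      then show "y \<in> (\<Union>n. (+) (?x n) ` future - F)" using y by blast
    qed
    ultimately show False using ne(2) negligible_subset by blast
  qed
  ultimately obtain h where h: "1-lipschitz_on UNIV h" "\<And>a b. b > h a \<Longrightarrow> (a, b) \<in> F'"
    "\<And>a b. (a, b) \<in> F' \<Longrightarrow> b \<ge> h a"
    using future_closed_epigraph[OF add] by blast
  let ?H = "{x. snd x > h (fst x)}"
  have "negligible ((F - F') \<union> {x. snd x = h (fst x)})"
    using diff negligible_graph[OF h(1)] by (rule negligible_Un)
  then have 1: "negligible (F - ?H)"
    by (rule negligible_subset) (use h(3) in force)
  have 2: "negligible (?H - F)"
  proof -
    \<comment> \<open>Each cone with apex above the graph lies in \<open>F\<close> up to a null set,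
      but there are uncountably many of them; Lindelof leaves a countable subfamily with the same
      union.\<close>
    obtain \<F> where \<F>: "\<F> \<subseteq> (\<lambda>x. (+) x ` future) ` ?H" "countable \<F>"
      "\<Union>\<F> = \<Union>((\<lambda>x. (+) x ` future) ` ?H)"
      using Lindelof[of "(\<lambda>x. (+) x ` future) ` ?H"] open_translate_future by blast
    have "negligible (\<Union>((\<lambda>S. S - F) ` \<F>))"
    proof (rule negligible_countable_Union)
      show "countable ((\<lambda>S. S - F) ` \<F>)" using \<F>(2) by simp
      fix S assume "S \<in> (\<lambda>S. S - F) ` \<F>"
      then obtain x where "x \<in> ?H" "S = (+) x ` future - F" using \<F>(1) by blast
      then show "negligible S" using cone[of x] h(2)[of "fst x" "snd x"] by simp
    qed
    moreover have "?H - F \<subseteq> \<Union>((\<lambda>S. S - F) ` \<F>)"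
    proof
      fix y assume y: "y \<in> ?H - F"
      \<comment> \<open>The midpoint between \<open>y\<close> and the graph on the same vertical
        line lies above the graph and has \<open>y\<close> in its future.\<close>
      define x where "x = (fst y, (snd y + h (fst y)) / 2)"
      have "x \<in> ?H" "y \<in> (+) x ` future"
        using y unfolding mem_translate_future by (auto simp: x_def future_def field_simps)
      then have "y \<in> \<Union>\<F>" unfolding \<F>(3) by blast
      then show "y \<in> \<Union>((\<lambda>S. S - F) ` \<F>)" using y by blast
    qed
    ultimately show ?thesis using negligible_subset by blast
  qed
  show ?thesis using that h(1) 1 2 by blast
qed

section \<open>Monotone directions of sets with constant normal\<close>

lemma negligible_AE:
  fixes P :: "'a::euclidean_space \<Rightarrow> bool"
  assumes "AE x in lborel. P x"
  shows "negligible {x. \<not> P x}"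
proof -
  obtain N where N: "{x. \<not> P x} \<subseteq> N" "N \<in> null_sets lborel"
    using AE_E[OF assms] by (auto simp: null_sets_def)
  then have "negligible N"
    by (simp add: negligible_iff_null_sets null_sets_completionI)
  then show ?thesis using N(1) negligible_subset by blast
qed

lemma vol_equivalent_iff_negligible:
  assumes "haar_measure \<mu>"
  shows "vol_equivalent \<mu> E F \<longleftrightarrow> negligible (E - F \<union> (F - E))"
proof -
  obtain c where c: "c > 0" "\<mu> = density lborel (\<lambda>_. ennreal c)"
    using haar_measure_eq[OF assms] .
  have "null_sets \<mu> = null_sets lborel"
    using c(1) by (auto simp: c(2) null_sets_def emeasure_density_const)
  then show ?thesis
    by (simp add: vol_equivalent_def negligible_iff_null_sets null_sets_completion_iff2)
qed



text \<open>This reduces everything to Lebesgue measure and a Borel set: a set of the completion is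
  Borel up to a null set, and \<open>\<mu>\<close> is a positive multiple of Lebesgue measure, so
  the integrals change only by a positive factor.\<close>

lemma haar_borel_representative:
  assumes \<mu>: "haar_measure \<mu>" and E: "E \<in> sets (completion \<mu>)"
  obtains S where "S \<in> sets borel" "negligible (E - S \<union> (S - E))"
    "\<And>X. deriv_indicator_nonneg \<mu> X E \<Longrightarrow> X \<in> monotone_dirs S"
    "\<And>X. deriv_indicator_zero \<mu> X E \<Longrightarrow> X \<in> monotone_dirs S \<and> - X \<in> monotone_dirs S"
proof -
  obtain c where c: "c > 0" "\<mu> = density lborel (\<lambda>_. ennreal c)"
    using haar_measure_eq[OF \<mu>] .
  obtain S N N' where S: "E = S \<union> N" "N \<subseteq> N'" "N' \<in> null_sets \<mu>" "S \<in> sets \<mu>"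
    using E by (rule sets_completionE)
  then have Sb [measurable]: "S \<in> sets borel" using \<mu> by (simp add: haar_measure_def)
  have sub: "E - S \<union> (S - E) \<subseteq> N'" using S(1,2) by auto
  have neg: "negligible (E - S \<union> (S - E))"
    using vol_equivalent_iff_negligible[OF \<mu>, of E S] sub S(3)
    by (auto simp: vol_equivalent_def null_sets_completion_iff2)
  have AE: "AE p in completion \<mu>. p \<in> E \<longleftrightarrow> p \<in> S"
    using S(1,2) by (intro AE_completion AE_I'[OF S(3)]) auto
  have int: "set_lebesgue_integral (completion \<mu>) E (left_inv_deriv X \<phi>)
      = c * (\<integral>p. indicator S p * left_inv_deriv X \<phi> p \<partial>lborel)" if "test_function \<phi>" for X \<phi>
  proof -
    have m [measurable]: "left_inv_deriv X \<phi> \<in> borel_measurable borel"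
      by (intro borel_measurable_continuous_onI continuous_left_inv_deriv that)
    have ms: "sets \<mu> = sets borel" using \<mu> by (simp add: haar_measure_def)
    have m2: "(\<lambda>p. indicator S p * left_inv_deriv X \<phi> p) \<in> borel_measurable \<mu>"
      unfolding measurable_cong_sets[OF ms refl] by measurable
    have m3: "left_inv_deriv X \<phi> \<in> borel_measurable (completion \<mu>)"
      using m by (intro measurable_completion) (simp add: measurable_cong_sets[OF ms refl])
    have "set_lebesgue_integral (completion \<mu>) E (left_inv_deriv X \<phi>)
        = (\<integral>p. indicator S p * left_inv_deriv X \<phi> p \<partial>completion \<mu>)"
      unfolding set_lebesgue_integral_def
    proof (rule integral_cong_AE)
      show "(\<lambda>p. indicator E p *\<^sub>R left_inv_deriv X \<phi> p) \<in> borel_measurable (completion \<mu>)"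
        using m3 E by (intro borel_measurable_scaleR borel_measurable_indicator)
      show "(\<lambda>p. indicator S p * left_inv_deriv X \<phi> p) \<in> borel_measurable (completion \<mu>)"
        by (rule measurable_completion[OF m2])
      show "AE p in completion \<mu>. indicator E p *\<^sub>R left_inv_deriv X \<phi> p = indicator S p * left_inv_deriv X \<phi> p"
        using AE by eventually_elim (auto simp: indicator_def)
    qed
    also have "\<dots> = (\<integral>p. indicator S p * left_inv_deriv X \<phi> p \<partial>\<mu>)"
      by (rule integral_completion[OF m2])
    also have "\<dots> = c * (\<integral>p. indicator S p * left_inv_deriv X \<phi> p \<partial>lborel)"
      unfolding c(2) using c(1) by (subst integral_density) simp_all
    finally show ?thesis .
  qed
  show ?thesis
  proof
    show "X \<in> monotone_dirs S" if "deriv_indicator_nonneg \<mu> X E" for X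
      using that c(1) by (auto simp: deriv_indicator_nonneg_def monotone_dirs_def int mult_le_0_iff)
    show "X \<in> monotone_dirs S \<and> - X \<in> monotone_dirs S" if "deriv_indicator_zero \<mu> X E" for X
      using that c(1) integral_left_inv_deriv_linear[OF Sb, of _ "-1" X 0 X]
      by (auto simp: deriv_indicator_zero_def monotone_dirs_def int)
  qed (fact Sb neg)+
qed

section \<open>The cone generated by the normal and its conjugates\<close>

lemma monotone_dirs_scale:
  assumes "E \<in> sets borel" "X \<in> monotone_dirs E" "a \<ge> 0"
  shows "a *\<^sub>R X \<in> monotone_dirs E"
  using monotone_dirs_cone[OF assms(1,2,2,3), of 0] by simp

lemma monotone_dirs_add:
  assumes "E \<in> sets borel" "X \<in> monotone_dirs E" "Y \<in> monotone_dirs E"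
  shows "X + Y \<in> monotone_dirs E"
  using monotone_dirs_cone[OF assms, of 1 1] by simp

lemma monotone_dirs_line:
  assumes "E \<in> sets borel" "X \<in> monotone_dirs E" "- X \<in> monotone_dirs E"
  shows "a *\<^sub>R X \<in> monotone_dirs E"
  using monotone_dirs_scale[OF assms(1,2), of a] monotone_dirs_scale[OF assms(1,3), of "- a"]
  by (cases "a \<ge> 0") simp_all

lemma flow_monotone_line:
  assumes "E \<in> sets borel" "X \<in> monotone_dirs E" "- X \<in> monotone_dirs E"
  shows "flow_monotone E (a *\<^sub>R X)"
  using flow_monotoneI[OF assms(1) monotone_dirs_line[OF assms], of 1 a] by simp

text \<open>\<open>monotone_dirs_leading\<close> applies with zero linear term after substituting
  \<open>s\<^sup>2\<close> and \<open>- s\<^sup>2\<close> for \<open>s\<close>.\<close>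

lemma monotone_dirs_leading_line:
  assumes "E \<in> sets borel" "\<And>s. X + s *\<^sub>R Y \<in> monotone_dirs E"
  shows "Y \<in> monotone_dirs E" "- Y \<in> monotone_dirs E"
proof -
  show "Y \<in> monotone_dirs E"
  proof (rule monotone_dirs_leading[OF assms(1)])
    show "X + s *\<^sub>R 0 + s\<^sup>2 *\<^sub>R Y \<in> monotone_dirs E" for s
      using assms(2)[of "s\<^sup>2"] by simp
  qed
  show "- Y \<in> monotone_dirs E"
  proof (rule monotone_dirs_leading[OF assms(1)])
    show "X + s *\<^sub>R 0 + s\<^sup>2 *\<^sub>R (- Y) \<in> monotone_dirs E" for s
      using assms(2)[of "- s\<^sup>2"] by simp
  qed
qed

text \<open>This is \<open>Ad (exp (s Y)) X\<^sub>2\<close> for every \<open>Y = X\<^sub>1 + m X\<^sub>2\<close>.\<close>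

definition parabola_dir :: "real \<Rightarrow> real^4" where
  "parabola_dir s = engel_X 2 + s *\<^sub>R engel_X 3 + (s\<^sup>2 / 2) *\<^sub>R engel_X 4"

lemma engel_X_nth: "engel_X i $ j = (if j = i then 1 else 0)"
  by (simp add: engel_X_def axis_def)

text \<open>These are the directions whose flows are composed in \<open>frame_flow\<close>. Only the
  two signs remember the normal, so four bases serve all \<open>X\<close>.\<close>

definition monotone_frame :: "(real^4) set \<Rightarrow> real \<Rightarrow> real \<Rightarrow> bool" where
  "monotone_frame E \<sigma> \<epsilon> \<longleftrightarrow> \<sigma> *\<^sub>R engel_X 1 \<in> monotone_dirs E
     \<and> (\<forall>s. \<epsilon> *\<^sub>R parabola_dir s \<in> monotone_dirs E) \<and> \<epsilon> *\<^sub>R engel_X 4 \<in> monotone_dirs E"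

text \<open>For \<open>Y = X_1 + m X_2\<close>, whatever \<open>m\<close> is,
  \<open>[Y, X_2] = X_3\<close> and \<open>[Y, X_3] = X_4\<close>. So conjugation along the
  invariant direction \<open>Y\<close> sweeps out the parabola, and its quadratic coefficient is
  half of \<open>\<epsilon> X_4\<close>.\<close>

lemma monotone_frame_transversal:
  assumes E: "E \<in> sets borel" and \<sigma>: "\<sigma> *\<^sub>R engel_X 1 \<in> monotone_dirs E"
    and Y: "engel_X 1 + m *\<^sub>R engel_X 2 \<in> monotone_dirs E" "- (engel_X 1 + m *\<^sub>R engel_X 2) \<in> monotone_dirs E"
    and \<epsilon>: "\<epsilon> *\<^sub>R engel_X 2 \<in> monotone_dirs E"
  shows "monotone_frame E \<sigma> \<epsilon>"
proof -
  let ?Y = "engel_X 1 + m *\<^sub>R engel_X 2"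
  have P: "\<epsilon> *\<^sub>R parabola_dir s \<in> monotone_dirs E" for s
  proof (rule monotone_dirs_conjugate[OF E _ _ \<epsilon>])
    show "flow_monotone E ((- s) *\<^sub>R ?Y)" by (rule flow_monotone_line[OF E Y])
    show "flow_monotone E (- ((- s) *\<^sub>R ?Y))"
      using flow_monotone_line[OF E Y, of s] by simp
    show "engel_mul (- ((- s) *\<^sub>R ?Y)) (engel_mul (t *\<^sub>R \<epsilon> *\<^sub>R engel_X 2) ((- s) *\<^sub>R ?Y))
        = t *\<^sub>R \<epsilon> *\<^sub>R parabola_dir s" for t
      by (simp add: vec_eq_iff forall_4 engel_mul_def parabola_dir_def engel_X_nth field_simps power2_eq_square)
  qed
  have "(\<epsilon> / 2) *\<^sub>R engel_X 4 \<in> monotone_dirs E"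
  proof (rule monotone_dirs_leading[OF E, where X = "\<epsilon> *\<^sub>R engel_X 2" and Y = "\<epsilon> *\<^sub>R engel_X 3"])
    show "\<epsilon> *\<^sub>R engel_X 2 + s *\<^sub>R \<epsilon> *\<^sub>R engel_X 3 + s\<^sup>2 *\<^sub>R (\<epsilon> / 2) *\<^sub>R engel_X 4 \<in> monotone_dirs E" for s
      using P[of s] by (simp add: parabola_dir_def scaleR_add_right mult.commute)
  qed
  from monotone_dirs_scale[OF E this, of 2] show ?thesis
    using P \<sigma> by (simp add: monotone_frame_def)
qed

text \<open>Conjugation along the invariant direction \<open>X_2\<close> adds arbitrary real
  multiples of \<open>X_3\<close> to \<open>X_1\<close>, which forces both signs of
  \<open>X_3\<close>; conjugation along \<open>X_3\<close> then forces both signs of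
  \<open>X_4\<close>. Every parabola direction is now monotone with either sign, and the sign 1 is a
  convention.\<close>

lemma monotone_frame_vertical:
  assumes E: "E \<in> sets borel" and \<sigma>: "\<sigma> *\<^sub>R engel_X 1 \<in> monotone_dirs E" "\<sigma> = 1 \<or> \<sigma> = -1"
    and X2: "engel_X 2 \<in> monotone_dirs E" "- engel_X 2 \<in> monotone_dirs E"
  shows "monotone_frame E \<sigma> 1"
proof -
  let ?X1 = "\<sigma> *\<^sub>R engel_X 1"
  have "?X1 + s *\<^sub>R \<sigma> *\<^sub>R engel_X 3 \<in> monotone_dirs E" for s
  proof (rule monotone_dirs_conjugate[OF E _ _ \<sigma>(1)])
    show "flow_monotone E (s *\<^sub>R engel_X 2)" by (rule flow_monotone_line[OF E X2])
    show "flow_monotone E (- (s *\<^sub>R engel_X 2))"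
      using flow_monotone_line[OF E X2, of "- s"] by simp
    show "engel_mul (- (s *\<^sub>R engel_X 2)) (engel_mul (t *\<^sub>R ?X1) (s *\<^sub>R engel_X 2))
        = t *\<^sub>R (?X1 + s *\<^sub>R \<sigma> *\<^sub>R engel_X 3)" for t
      by (simp add: vec_eq_iff forall_4 engel_mul_def engel_X_nth field_simps)
  qed
  from monotone_dirs_leading_line[OF E this]
  have X3: "engel_X 3 \<in> monotone_dirs E" "- engel_X 3 \<in> monotone_dirs E" using \<sigma>(2) by auto
  have "?X1 + s *\<^sub>R \<sigma> *\<^sub>R engel_X 4 \<in> monotone_dirs E" for s
  proof (rule monotone_dirs_conjugate[OF E _ _ \<sigma>(1)])
    show "flow_monotone E (s *\<^sub>R engel_X 3)" by (rule flow_monotone_line[OF E X3])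
    show "flow_monotone E (- (s *\<^sub>R engel_X 3))"
      using flow_monotone_line[OF E X3, of "- s"] by simp
    show "engel_mul (- (s *\<^sub>R engel_X 3)) (engel_mul (t *\<^sub>R ?X1) (s *\<^sub>R engel_X 3))
        = t *\<^sub>R (?X1 + s *\<^sub>R \<sigma> *\<^sub>R engel_X 4)" for t
      by (simp add: vec_eq_iff forall_4 engel_mul_def engel_X_nth field_simps)
  qed
  from monotone_dirs_leading_line[OF E this]
  have X4: "engel_X 4 \<in> monotone_dirs E" "- engel_X 4 \<in> monotone_dirs E" using \<sigma>(2) by auto
  show ?thesis
    unfolding monotone_frame_def parabola_dir_def
    using \<sigma>(1) X2 X4 by (auto intro!: monotone_dirs_add[OF E] monotone_dirs_line[OF E] X3)
qed

lemma engel_V1_iff: "X \<in> engel_V1 \<longleftrightarrow> (\<exists>a b. X = a *\<^sub>R engel_X 1 + b *\<^sub>R engel_X 2)"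
  unfolding engel_V1_def by (auto simp: span_insert span_singleton algebra_simps)

text \<open>The signs are produced before \<open>E\<close> is given, since the basis in the theorem
  may depend on \<open>X\<close> but not on \<open>E\<close>.\<close>

lemma constant_normal_frame:
  assumes ip: "scalar_product_on engel_V1 ip" and X: "X \<in> engel_V1"
  obtains \<sigma> \<epsilon> :: real where "\<sigma> = 1 \<or> \<sigma> = -1" "\<epsilon> = 1 \<or> \<epsilon> = -1"
    "\<And>E. E \<in> sets borel \<Longrightarrow> X \<in> monotone_dirs E \<Longrightarrow>
      \<forall>Y\<in>engel_V1. ip X Y = 0 \<longrightarrow> Y \<in> monotone_dirs E \<and> - Y \<in> monotone_dirs E \<Longrightarrow>
      monotone_frame E \<sigma> \<epsilon>"
proof -
  define P Q where "P = ip X (engel_X 1)" and "Q = ip X (engel_X 2)"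
  have V: "a *\<^sub>R engel_X 1 + b *\<^sub>R engel_X 2 \<in> engel_V1" for a b by (auto simp: engel_V1_iff)
  have V1: "engel_X 1 \<in> engel_V1" and V2: "engel_X 2 \<in> engel_V1"
    by (simp_all add: engel_V1_def span_base)
  have ip_sym: "ip y z = ip z y" and ip_add: "w \<in> engel_V1 \<Longrightarrow> ip (w + y) z = ip w z + ip y z"
    and ip_scale: "ip (c *\<^sub>R y) z = c * ip y z" if "y \<in> engel_V1" "z \<in> engel_V1" for w y z c
    using ip that unfolding scalar_product_on_def by auto
  have ip_eq: "ip X (a *\<^sub>R engel_X 1 + b *\<^sub>R engel_X 2) = a * P + b * Q" for a b
  proof -
    have W: "a *\<^sub>R engel_X 1 \<in> engel_V1" "b *\<^sub>R engel_X 2 \<in> engel_V1"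
      using V1 V2 by (simp_all add: engel_V1_def span_scale)
    show ?thesis
      unfolding P_def Q_def ip_sym[OF X V] ip_sym[OF X V1] ip_sym[OF X V2]
        ip_add[OF W(2) X W(1)] ip_scale[OF V1 X] ip_scale[OF V2 X] ..
  qed
  obtain x1 x2 where x: "X = x1 *\<^sub>R engel_X 1 + x2 *\<^sub>R engel_X 2"
    using X by (auto simp: engel_V1_iff)
  define \<sigma> \<epsilon> :: real where "\<sigma> = (if P \<ge> 0 then 1 else -1)" and "\<epsilon> = (if Q \<ge> 0 then 1 else -1)"
  show ?thesis
  proof
    fix E assume E: "E \<in> sets borel" and XE: "X \<in> monotone_dirs E"
      and orth: "\<forall>Y\<in>engel_V1. ip X Y = 0 \<longrightarrow> Y \<in> monotone_dirs E \<and> - Y \<in> monotone_dirs E"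
    have orth': "a *\<^sub>R engel_X 1 + b *\<^sub>R engel_X 2 \<in> monotone_dirs E"
      "- (a *\<^sub>R engel_X 1 + b *\<^sub>R engel_X 2) \<in> monotone_dirs E" if "a * P + b * Q = 0" for a b
      using orth[rule_format, OF V] ip_eq that by auto
    show "monotone_frame E \<sigma> \<epsilon>"
    proof (cases "X = 0")
      \<comment> \<open>Every horizontal direction is orthogonal to \<open>X = 0\<close>, so both
        signs of \<open>X_1\<close> and of \<open>X_2\<close> are monotone and the default signs
        will do.\<close>
      case True
      have "P = 0" "Q = 0"
        using ip_scale[OF X V1, of 0] ip_scale[OF X V2, of 0] True by (simp_all add: P_def Q_def)
      then show ?thesis
        using orth'[of 1 0] orth'[of 0 1]
        by (intro monotone_frame_transversal[OF E, where m = 0]) (simp_all add: \<sigma>_def \<epsilon>_def)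
    next
      case False
      define D where "D = x1 * P + x2 * Q"
      have "ip X X > 0" using ip X False unfolding scalar_product_on_def by blast
      then have "D > 0" using ip_eq[of x1 x2] by (simp add: D_def flip: x)
      \<comment> \<open>\<open>P\<close> and \<open>Q\<close> are the coefficients of
        \<open>ip X\<close>, so \<open>?Y\<close> spans the orthogonal complement of
        \<open>X\<close>, and \<open>D = ip X X\<close> is the determinant of \<open>X\<close> and
        \<open>?Y\<close>. The two combinations below are Cramer's rule, with signs that keep the
        coefficient of \<open>X\<close> nonnegative.\<close>
      let ?Y = "(- Q) *\<^sub>R engel_X 1 + P *\<^sub>R engel_X 2"
      have Y: "?Y \<in> monotone_dirs E" "- ?Y \<in> monotone_dirs E" by (rule orth'; simp)+
      have "\<bar>P\<bar> *\<^sub>R X + (- \<sigma> * x2) *\<^sub>R ?Y \<in> monotone_dirs E"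
        by (intro monotone_dirs_add[OF E] monotone_dirs_scale[OF E XE] monotone_dirs_line[OF E Y]) simp
      also have "\<bar>P\<bar> *\<^sub>R X + (- \<sigma> * x2) *\<^sub>R ?Y = D *\<^sub>R \<sigma> *\<^sub>R engel_X 1"
        unfolding x by (simp add: vec_eq_iff forall_4 engel_X_nth \<sigma>_def D_def algebra_simps)
      finally have \<sigma>: "\<sigma> *\<^sub>R engel_X 1 \<in> monotone_dirs E"
        using monotone_dirs_scale[OF E, of "D *\<^sub>R \<sigma> *\<^sub>R engel_X 1" "1 / D"] \<open>D > 0\<close> by simp
      have "\<bar>Q\<bar> *\<^sub>R X + (\<epsilon> * x1) *\<^sub>R ?Y \<in> monotone_dirs E"
        by (intro monotone_dirs_add[OF E] monotone_dirs_scale[OF E XE] monotone_dirs_line[OF E Y]) simp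
      also have "\<bar>Q\<bar> *\<^sub>R X + (\<epsilon> * x1) *\<^sub>R ?Y = D *\<^sub>R \<epsilon> *\<^sub>R engel_X 2"
        unfolding x by (simp add: vec_eq_iff forall_4 engel_X_nth \<epsilon>_def D_def algebra_simps)
      finally have \<epsilon>: "\<epsilon> *\<^sub>R engel_X 2 \<in> monotone_dirs E"
        using monotone_dirs_scale[OF E, of "D *\<^sub>R \<epsilon> *\<^sub>R engel_X 2" "1 / D"] \<open>D > 0\<close> by simp
      show ?thesis
      \<comment> \<open>\<open>Q = 0\<close> says that \<open>X_2\<close> itself is orthogonal to
        \<open>X\<close>. Otherwise the orthogonal line is spanned by \<open>X_1 + m X_2\<close>
        with \<open>m = - P / Q\<close>.\<close>
      proof (cases "Q = 0")
        case True
        have "monotone_frame E \<sigma> 1"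
          using orth'[of 0 1] True \<sigma> by (intro monotone_frame_vertical[OF E]) (auto simp: \<sigma>_def)
        then show ?thesis using True by (simp add: \<epsilon>_def)
      next
        case False
        show ?thesis
          using orth'[of 1 "- P / Q"] False
          by (intro monotone_frame_transversal[OF E \<sigma> _ _ \<epsilon>, where m = "- P / Q"]) simp_all
      qed
    qed
  qed (simp_all add: \<sigma>_def \<epsilon>_def)
qed

section \<open>Exponential coordinates of the second kind\<close>

lemma flow_monotone_mul:
  assumes "flow_monotone E g" "flow_monotone E h"
  shows "flow_monotone E (engel_mul g h)"
  using assms(1) AE_lborel_engel_mul_right[OF assms(2)[unfolded flow_monotone_def], of g]
  unfolding flow_monotone_def by eventually_elim (simp add: engel_mul_assoc)

text \<open>\<open>\<theta>$3\<close> selects a field of the parabola and is not a time, hence its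
  sign is free in \<open>flow_times\<close>. It supplies the fourth parameter needed to fill an open
  set.\<close>

definition frame_flow :: "real \<Rightarrow> real \<Rightarrow> real^4 \<Rightarrow> real^4 \<Rightarrow> real^4" where
  "frame_flow \<sigma> \<epsilon> p \<theta> = engel_mul p (engel_mul (engel_mul
     (\<theta>$1 *\<^sub>R \<sigma> *\<^sub>R engel_X 1) (\<theta>$2 *\<^sub>R \<epsilon> *\<^sub>R parabola_dir (\<theta>$3))) (\<theta>$4 *\<^sub>R \<epsilon> *\<^sub>R engel_X 4))"

definition flow_times :: "(real^4) set" where
  "flow_times = {\<theta>. 0 \<le> \<theta>$1 \<and> 0 \<le> \<theta>$2 \<and> 0 \<le> \<theta>$4}"

text \<open>For each fixed \<open>\<theta>\<close> the composed flow leads out of \<open>E\<close>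
  only from a null set of points of \<open>E\<close>. Fubini exchanges the two quantifiers "almost
  every".\<close>

lemma monotone_frame_negligible:
  assumes E [measurable]: "E \<in> sets borel" and "monotone_frame E \<sigma> \<epsilon>"
  shows "negligible {p \<in> E. \<not> negligible {\<theta> \<in> flow_times. frame_flow \<sigma> \<epsilon> p \<theta> \<notin> E}}"
proof -
  have F: "flow_monotone E (t *\<^sub>R \<sigma> *\<^sub>R engel_X 1)" "flow_monotone E (t *\<^sub>R \<epsilon> *\<^sub>R parabola_dir s)"
    "flow_monotone E (t *\<^sub>R \<epsilon> *\<^sub>R engel_X 4)" if "t \<ge> 0" for t s
    using assms(2) that
    by (auto simp: monotone_frame_def simp del: scaleR_scaleR intro: flow_monotoneI[OF E])
  have "AE p in lborel. \<theta> \<in> flow_times \<longrightarrow> p \<in> E \<longrightarrow> frame_flow \<sigma> \<epsilon> p \<theta> \<in> E" for \<theta>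
  proof (cases "\<theta> \<in> flow_times")
    case True
    then have "flow_monotone E (engel_mul (engel_mul
       (\<theta>$1 *\<^sub>R \<sigma> *\<^sub>R engel_X 1) (\<theta>$2 *\<^sub>R \<epsilon> *\<^sub>R parabola_dir (\<theta>$3))) (\<theta>$4 *\<^sub>R \<epsilon> *\<^sub>R engel_X 4))"
      by (intro flow_monotone_mul F) (auto simp: flow_times_def)
    then show ?thesis unfolding flow_monotone_def frame_flow_def by eventually_elim simp
  qed simp
  then have "AE \<theta> in lborel. AE p in lborel. \<theta> \<in> flow_times \<longrightarrow> p \<in> E \<longrightarrow> frame_flow \<sigma> \<epsilon> p \<theta> \<in> E"
    by simp
  moreover have "{z \<in> space (lborel \<Otimes>\<^sub>M lborel). snd z \<in> flow_times \<longrightarrow> fst z \<in> E \<longrightarrow>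
      frame_flow \<sigma> \<epsilon> (fst z) (snd z) \<in> E} \<in> sets (lborel \<Otimes>\<^sub>M lborel)"
  proof -
    have "closed flow_times"
      unfolding flow_times_def by (intro closed_Collect_conj closed_Collect_le continuous_intros)
    then have T [measurable]: "flow_times \<in> sets borel" by simp
    have "(\<lambda>z. frame_flow \<sigma> \<epsilon> (fst z) (snd z)) \<in> borel_measurable borel"
      unfolding frame_flow_def parabola_dir_def
      by (intro borel_measurable_continuous_onI continuous_intros) simp_all
    then have G [measurable]: "(\<lambda>z. frame_flow \<sigma> \<epsilon> (fst z) (snd z)) \<in> borel_measurable (lborel \<Otimes>\<^sub>M lborel)"
      by (simp add: borel_prod[symmetric])
    show ?thesis by measurable
  qed
  ultimately have "AE p in lborel. AE \<theta> in lborel. \<theta> \<in> flow_times \<longrightarrow> p \<in> E \<longrightarrow> frame_flow \<sigma> \<epsilon> p \<theta> \<in> E"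
    by (subst lborel_pair.AE_commute) simp_all
  then have "AE p in lborel. p \<in> E \<longrightarrow> negligible {\<theta> \<in> flow_times. frame_flow \<sigma> \<epsilon> p \<theta> \<notin> E}"
  proof eventually_elim
    fix p assume "AE \<theta> in lborel. \<theta> \<in> flow_times \<longrightarrow> p \<in> E \<longrightarrow> frame_flow \<sigma> \<epsilon> p \<theta> \<in> E"
    from negligible_AE[OF this] show "p \<in> E \<longrightarrow> negligible {\<theta> \<in> flow_times. frame_flow \<sigma> \<epsilon> p \<theta> \<notin> E}"
      by (cases "p \<in> E") simp_all
  qed
  from negligible_AE[OF this] show ?thesis by simp
qed

lemma smooth_differentiable_on: "smooth f \<Longrightarrow> f differentiable_on S"
  unfolding differentiable_on_def
  using smooth_has_derivative differentiable_def differentiable_at_withinI by blast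

lemma differentiable_on_smooth_scaleR:
  "smooth f \<Longrightarrow> (\<lambda>x. f x *\<^sub>R c) differentiable_on S"
  by (intro differentiable_on_scaleR smooth_differentiable_on differentiable_on_const)

lemma engel_Psi_nth:
  "engel_Psi x $ 1 = x$1" "engel_Psi x $ 2 = x$2" "engel_Psi x $ 3 = x$3 - x$1 * x$2 / 2"
  "engel_Psi x $ 4 = x$4 - x$1 * x$3 / 2 + (x$1)\<^sup>2 * x$2 / 12"
  by (simp_all add: engel_Psi_def engel_exp_def engel_mul_def engel_X_nth field_simps power2_eq_square)

text \<open>Chosen so that the corresponding linear map sends the cone \<open>future\<close> into
  \<open>{x. \<sigma> x\<^sub>1 > 0 \<and> \<epsilon> x\<^sub>2 > 0 \<and> 2 x\<^sub>2 x\<^sub>4 > x\<^sub>3\<^sup>2}\<close>.\<close>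

definition frame_basis :: "real \<Rightarrow> real \<Rightarrow> (real^4) \<times> (real^4) \<times> (real^4) \<times> (real^4)" where
  "frame_basis \<sigma> \<epsilon> = (vector [\<sigma>, 0, 0, 0], vector [0, \<epsilon>, 0, - \<epsilon>], vector [0, 0, \<epsilon>, 0], vector [\<sigma>, \<epsilon>, 0, \<epsilon>])"

definition frame_map :: "real \<Rightarrow> real \<Rightarrow> (real^3) \<times> real \<Rightarrow> real^4" where
  "frame_map \<sigma> \<epsilon> z = (case frame_basis \<sigma> \<epsilon> of (w1, w2, w3, w4) \<Rightarrow>
     fst z $ 1 *\<^sub>R w1 + fst z $ 2 *\<^sub>R w2 + fst z $ 3 *\<^sub>R w3 + snd z *\<^sub>R w4)"

lemma frame_map_nth:
  "frame_map \<sigma> \<epsilon> z $ 1 = \<sigma> * (fst z $ 1 + snd z)" "frame_map \<sigma> \<epsilon> z $ 2 = \<epsilon> * (fst z $ 2 + snd z)"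
  "frame_map \<sigma> \<epsilon> z $ 3 = \<epsilon> * fst z $ 3" "frame_map \<sigma> \<epsilon> z $ 4 = \<epsilon> * (snd z - fst z $ 2)"
  by (simp_all add: frame_map_def frame_basis_def vector_4 algebra_simps)

lemma linear_frame_map: "linear (frame_map \<sigma> \<epsilon>)"
  by (intro linearI) (simp_all add: vec_eq_iff forall_4 frame_map_nth algebra_simps)

definition frame_coords :: "real \<Rightarrow> real \<Rightarrow> (real^3) \<times> real \<Rightarrow> real^4" where
  "frame_coords \<sigma> \<epsilon> z = engel_Psi (frame_map \<sigma> \<epsilon> z)"

text \<open>\<open>x3\<close> and \<open>x4\<close> solve \<open>engel_Psi_nth\<close> for the
  coordinates of the second kind; the rest inverts \<open>frame_map\<close>, the signs being their
  own inverses. Writing it as scalar functions times fixed vectors makes differentiability a matter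
  of \<open>differentiable_on_smooth_scaleR\<close>.\<close>

definition frame_inverse :: "real \<Rightarrow> real \<Rightarrow> real^4 \<Rightarrow> (real^3) \<times> real" where
  "frame_inverse \<sigma> \<epsilon> p =
    (let x3 = p$3 + p$1 * p$2 / 2; x4 = p$4 + p$1 * x3 / 2 - p$1 * p$1 * p$2 / 12;
         b = \<epsilon> * (p$2 + x4) / 2
     in (\<sigma> * p$1 - b) *\<^sub>R (axis 1 1, 0) + (\<epsilon> * (p$2 - x4) / 2) *\<^sub>R (axis 2 1, 0)
        + (\<epsilon> * x3) *\<^sub>R (axis 3 1, 0) + b *\<^sub>R (0, 1))"

lemma differentiable_frame_inverse: "frame_inverse \<sigma> \<epsilon> differentiable_on S"
  unfolding frame_inverse_def[abs_def] Let_def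
  by (intro differentiable_on_add differentiable_on_smooth_scaleR smooth_intros)

lemma frame_inverse:
  assumes "\<sigma> = 1 \<or> \<sigma> = -1" "\<epsilon> = 1 \<or> \<epsilon> = -1"
  shows "frame_inverse \<sigma> \<epsilon> (frame_coords \<sigma> \<epsilon> z) = z" "frame_coords \<sigma> \<epsilon> (frame_inverse \<sigma> \<epsilon> p) = p"
proof -
  show "frame_inverse \<sigma> \<epsilon> (frame_coords \<sigma> \<epsilon> z) = z"
    using assms
    by (auto simp: frame_inverse_def frame_coords_def Let_def engel_Psi_nth frame_map_nth prod_eq_iff
        vec_eq_iff forall_3 axis_def field_simps power2_eq_square)
  show "frame_coords \<sigma> \<epsilon> (frame_inverse \<sigma> \<epsilon> p) = p"
    using assms
    by (auto simp: frame_inverse_def frame_coords_def Let_def engel_Psi_nth frame_map_nth prod_eq_iff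
        vec_eq_iff forall_4 axis_def field_simps power2_eq_square)
qed

lemma negligible_frame_coords:
  assumes "negligible S"
  shows "negligible (frame_coords \<sigma> \<epsilon> ` S)"
proof -
  have Psi: "engel_Psi = (\<lambda>x. \<Sum>i\<in>UNIV. (engel_Psi x $ i) *\<^sub>R axis i 1)"
    using basis_expansion[of "engel_Psi x" for x] by (simp add: scalar_mult_eq_scaleR)
  have "smooth (\<lambda>x. engel_Psi x $ i)" for i
  proof -
    have "\<forall>i. smooth (\<lambda>x. engel_Psi x $ i)"
      unfolding forall_4 engel_Psi_nth by (intro conjI smooth_intros)
    then show ?thesis ..
  qed
  then have "(\<lambda>x. \<Sum>i\<in>UNIV. (engel_Psi x $ i) *\<^sub>R axis i 1) differentiable_on T" for T
    unfolding sum_4 by (intro differentiable_on_add differentiable_on_smooth_scaleR)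
  then have diff: "engel_Psi differentiable_on T" for T by (subst Psi)
  have "negligible (frame_map \<sigma> \<epsilon> ` S)"
    by (rule negligible_differentiable_image_negligible[OF _ assms])
       (simp_all add: linear_imp_differentiable_on linear_frame_map)
  from negligible_differentiable_image_negligible[OF _ this diff]
  have "negligible (engel_Psi ` frame_map \<sigma> \<epsilon> ` S)" by simp
  then show ?thesis by (simp add: frame_coords_def image_image)
qed

text \<open>The displacement caused by \<open>frame_flow\<close> in the coordinates \<open>frame_coords\<close>; it depends on the
  base point only through its first coordinate \<open>y\<close>.\<close>

definition frame_shift :: "real \<Rightarrow> real \<Rightarrow> real \<Rightarrow> real^4 \<Rightarrow> (real^3) \<times> real" where
  "frame_shift \<sigma> \<epsilon> y \<theta> =
    (let s = \<theta>$3 + y + \<sigma> * \<theta>$1; x4 = \<theta>$2 * (s * s) / 2 + \<theta>$4; b = (\<theta>$2 + x4) / 2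
     in (\<theta>$1 - b) *\<^sub>R (axis 1 1, 0) + ((\<theta>$2 - x4) / 2) *\<^sub>R (axis 2 1, 0)
        + (\<theta>$2 * s) *\<^sub>R (axis 3 1, 0) + b *\<^sub>R (0, 1))"

lemma differentiable_frame_shift: "frame_shift \<sigma> \<epsilon> y differentiable_on S"
  unfolding frame_shift_def[abs_def] Let_def
  by (intro differentiable_on_add differentiable_on_smooth_scaleR smooth_intros)

text \<open>The \<open>X_1\<close> flow acts first and moves the first coordinate to
  \<open>y + \<sigma> * \<theta>$1\<close>. The later fields depend only on that coordinate and do
  not change it, so their flows are translations.\<close>

lemma frame_flow_coords:
  assumes "\<sigma> = 1 \<or> \<sigma> = -1" "\<epsilon> = 1 \<or> \<epsilon> = -1"
  shows "frame_flow \<sigma> \<epsilon> (frame_coords \<sigma> \<epsilon> z) \<theta>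
    = frame_coords \<sigma> \<epsilon> (z + frame_shift \<sigma> \<epsilon> (frame_map \<sigma> \<epsilon> z $ 1) \<theta>)"
  using assms
  by (auto simp: frame_flow_def frame_coords_def frame_shift_def Let_def engel_Psi_nth frame_map_nth
      engel_mul_def parabola_dir_def engel_X_nth vec_eq_iff forall_4 axis_def field_simps power2_eq_square)

text \<open>The base point enters only through \<open>y\<close>, which the free parameter
  \<open>\<theta>$3\<close> absorbs, so the same cone is reached from everywhere.\<close>

lemma frame_shift_surj:
  assumes \<sigma>: "\<sigma> = 1 \<or> \<sigma> = -1" and v: "v \<in> future"
  obtains \<theta> where "\<theta> \<in> flow_times" "frame_shift \<sigma> \<epsilon> y \<theta> = v"
proof -
  define a1 a2 a3 b where "a1 = fst v $ 1" and "a2 = fst v $ 2" and "a3 = fst v $ 3" and "b = snd v"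
  have "norm (fst v) < b" using v by (simp add: future_def b_def)
  then have "\<bar>a1\<bar> < b" "\<bar>a2\<bar> < b"
    using component_le_norm_cart[of "fst v" 1] component_le_norm_cart[of "fst v" 2]
    by (auto simp: a1_def a2_def)
  then have pos: "a1 + b > 0" "a2 + b > 0" by auto
  have "(norm (fst v))\<^sup>2 < b\<^sup>2"
    using \<open>norm (fst v) < b\<close> by (intro power_strict_mono) auto
  moreover have "(norm (fst v))\<^sup>2 = a1\<^sup>2 + a2\<^sup>2 + a3\<^sup>2"
    by (simp add: norm_vec_def L2_set_def sum_nonneg sum_3 a1_def a2_def a3_def)
  ultimately have "a2\<^sup>2 + a3\<^sup>2 < b\<^sup>2"
    using zero_le_power2[of a1] by linarith
  then have "a3\<^sup>2 < (b - a2) * (b + a2)"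
    by (simp add: power2_eq_square algebra_simps)
  then have \<tau>: "b - a2 - a3 * (a3 / (a2 + b)) / 2 \<ge> 0"
  proof -
    have "a3\<^sup>2 \<le> 2 * ((b - a2) * (b + a2))"
      using \<open>a3\<^sup>2 < (b - a2) * (b + a2)\<close> zero_le_power2[of a3] by linarith
    moreover have "b - a2 - a3 * (a3 / (a2 + b)) / 2 = (2 * ((b - a2) * (b + a2)) - a3\<^sup>2) / (2 * (a2 + b))"
      using pos by (simp add: field_simps power2_eq_square)
    ultimately show ?thesis using pos by simp
  qed
  \<comment> \<open>Solved from \<open>frame_shift\<close>: up to signs, the first two times are the
    increments of \<open>x_1\<close> and \<open>x_2\<close>, the slope \<open>s\<close> is the
    increment of \<open>x_3\<close> over that of \<open>x_2\<close>, and the last time is what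
    remains of the increment of \<open>x_4\<close> after the parabola flow has contributed
    \<open>a3\<^sup>2 / (2 * (a2 + b))\<close>.\<close>
  let ?\<theta> = "vector [a1 + b, a2 + b, a3 / (a2 + b) - y - \<sigma> * (a1 + b),
     b - a2 - a3 * (a3 / (a2 + b)) / 2] :: real^4"
  have "?\<theta> \<in> flow_times" using pos \<tau> by (simp add: flow_times_def vector_4)
  moreover have "frame_shift \<sigma> \<epsilon> y ?\<theta> = v"
  proof -
    have s: "(a2 + b) * (a3 / (a2 + b)) = a3" "(a2 + b) * (a3 / (a2 + b) * (a3 / (a2 + b))) = a3 * (a3 / (a2 + b))"
      using pos by simp_all
    show ?thesis
      using pos by (simp add: frame_shift_def Let_def vector_4 s)
         (simp add: prod_eq_iff vec_eq_iff forall_3 axis_def a1_def a2_def a3_def b_def field_simps)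
  qed
  ultimately show ?thesis using that by blast
qed

text \<open>\<open>frame_coords\<close> and its inverse are differentiable and so preserve null
  sets. In these coordinates the displacements of \<open>frame_flow\<close> cover
  \<open>future\<close>, which reduces the claim to \<open>future_monotone_epigraph\<close>.\<close>

lemma monotone_frame_epigraph:
  assumes E: "E \<in> sets borel" and frame: "monotone_frame E \<sigma> \<epsilon>"
    and signs: "\<sigma> = 1 \<or> \<sigma> = -1" "\<epsilon> = 1 \<or> \<epsilon> = -1"
    and ne: "\<not> negligible E" "\<not> negligible (- E)"
  obtains h where "1-lipschitz_on UNIV h"
    "negligible (E - frame_coords \<sigma> \<epsilon> ` {z. snd z > h (fst z)})"
    "negligible (frame_coords \<sigma> \<epsilon> ` {z. snd z > h (fst z)} - E)"
proof -
  let ?\<Phi> = "frame_coords \<sigma> \<epsilon>" and ?G = "frame_flow \<sigma> \<epsilon>"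
  note inv = frame_inverse[OF signs]
  define F where "F = ?\<Phi> -` E"
  have im: "?\<Phi> ` (?\<Phi> -` S) = S" for S
    using inv(2) by (metis surj_def surj_image_vimage_eq)
  have neg: "negligible S" if "negligible (?\<Phi> -` S)" for S
    using negligible_frame_coords[OF that, of \<sigma> \<epsilon>] unfolding im .
  have "negligible {z \<in> F. \<not> negligible {v \<in> future. z + v \<notin> F}}"
  proof (rule negligible_subset)
    let ?B = "{p \<in> E. \<not> negligible {\<theta> \<in> flow_times. ?G p \<theta> \<notin> E}}"
    show "negligible (frame_inverse \<sigma> \<epsilon> ` ?B)"
      by (rule negligible_differentiable_image_negligible[OF _ monotone_frame_negligible[OF E frame]])
         (simp_all add: differentiable_frame_inverse)
    show "{z \<in> F. \<not> negligible {v \<in> future. z + v \<notin> F}} \<subseteq> frame_inverse \<sigma> \<epsilon> ` ?B"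
    proof clarify
      fix z assume z: "z \<in> F" and nn: "\<not> negligible {v \<in> future. z + v \<notin> F}"
      have "\<not> negligible {\<theta> \<in> flow_times. ?G (?\<Phi> z) \<theta> \<notin> E}"
      proof
        assume "negligible {\<theta> \<in> flow_times. ?G (?\<Phi> z) \<theta> \<notin> E}"
        then have "negligible (frame_shift \<sigma> \<epsilon> (frame_map \<sigma> \<epsilon> z $ 1) ` {\<theta> \<in> flow_times. ?G (?\<Phi> z) \<theta> \<notin> E})"
          by (intro negligible_differentiable_image_negligible differentiable_frame_shift) simp_all
        \<comment> \<open>A displacement leading out of \<open>F\<close> is the shift of some
          \<open>\<theta>\<close> leading out of \<open>E\<close>. The bad displacements thus lie in
          the differentiable image of a null set, between spaces of equal dimension.\<close>
        moreover have "{v \<in> future. z + v \<notin> F}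
            \<subseteq> frame_shift \<sigma> \<epsilon> (frame_map \<sigma> \<epsilon> z $ 1) ` {\<theta> \<in> flow_times. ?G (?\<Phi> z) \<theta> \<notin> E}"
        proof clarify
          fix v assume v: "v \<in> future" "z + v \<notin> F"
          obtain \<theta> where "\<theta> \<in> flow_times" "frame_shift \<sigma> \<epsilon> (frame_map \<sigma> \<epsilon> z $ 1) \<theta> = v"
            using frame_shift_surj[OF signs(1) v(1)] .
          then show "v \<in> frame_shift \<sigma> \<epsilon> (frame_map \<sigma> \<epsilon> z $ 1) ` {\<theta> \<in> flow_times. ?G (?\<Phi> z) \<theta> \<notin> E}"
            using v(2) frame_flow_coords[OF signs, of z \<theta>] by (auto simp: F_def)
        qed
        ultimately show False using nn negligible_subset by blast
      qed
      then have "?\<Phi> z \<in> ?B" using z by (simp add: F_def)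
      then have "frame_inverse \<sigma> \<epsilon> (?\<Phi> z) \<in> frame_inverse \<sigma> \<epsilon> ` ?B" by (rule imageI)
      then show "z \<in> frame_inverse \<sigma> \<epsilon> ` ?B" by (simp add: inv)
    qed
  qed
  moreover have "\<not> negligible F" using ne(1) neg[of E] by (auto simp: F_def)
  moreover have "\<not> negligible (- F)" using ne(2) neg[of "- E"] by (auto simp: F_def vimage_Compl)
  ultimately obtain h where h: "1-lipschitz_on UNIV h"
    "negligible (F - {x. snd x > h (fst x)})" "negligible ({x. snd x > h (fst x)} - F)"
    using future_monotone_epigraph by blast
  let ?H = "{x. snd x > h (fst x)}"
  have "inj ?\<Phi>" using inv(1) by (metis injI)
  then have "?\<Phi> ` (F - ?H) = E - ?\<Phi> ` ?H" "?\<Phi> ` (?H - F) = ?\<Phi> ` ?H - E"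
    by (simp_all only: image_set_diff F_def im)
  then show ?thesis
    using that[OF h(1)] negligible_frame_coords[OF h(2), of \<sigma> \<epsilon>] negligible_frame_coords[OF h(3), of \<sigma> \<epsilon>] by simp
qed

lemma frame_basis_basis:
  assumes "frame_basis \<sigma> \<epsilon> = (w1, w2, w3, w4)" and signs: "\<sigma> = 1 \<or> \<sigma> = -1" "\<epsilon> = 1 \<or> \<epsilon> = -1"
  shows "distinct [w1, w2, w3, w4]" "independent {w1, w2, w3, w4}" "span {w1, w2, w3, w4} = UNIV"
proof -
  show dist: "distinct [w1, w2, w3, w4]"
    using assms by (auto simp: frame_basis_def vec_eq_iff forall_4 vector_4)
  show span: "span {w1, w2, w3, w4} = UNIV"
  proof (intro equalityI subsetI UNIV_I)
    fix p :: "real^4"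

    obtain z where z: "frame_map \<sigma> \<epsilon> z = p"
    proof
      show "frame_map \<sigma> \<epsilon> (vector [\<sigma> * p$1 - \<epsilon> * (p$2 + p$4) / 2, \<epsilon> * (p$2 - p$4) / 2, \<epsilon> * p$3],
          \<epsilon> * (p$2 + p$4) / 2) = p"
        using signs by (auto simp: vec_eq_iff forall_4 frame_map_nth vector_3 field_simps)
    qed
    then have "p = fst z $ 1 *\<^sub>R w1 + fst z $ 2 *\<^sub>R w2 + fst z $ 3 *\<^sub>R w3 + snd z *\<^sub>R w4"
      by (simp add: frame_map_def assms(1))
    also have "\<dots> \<in> span {w1, w2, w3, w4}"
      by (intro span_add span_scale span_base) auto
    finally show "p \<in> span {w1, w2, w3, w4}" .
  qed
  have "card {w1, w2, w3, w4} = 4" using distinct_card[OF dist] by simp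
  then show "independent {w1, w2, w3, w4}"
    using span by (intro card_le_dim_spanning[of _ UNIV]) simp_all
qed

text \<open>The sets \<open>{}\<close> and \<open>UNIV\<close> have every horizontal vector as
  constant normal, but the epigraph of a real-valued function is neither null nor of full measure.
  This is why sets equivalent to one of these two are excluded.\<close>

theorem theorem1p5:
  fixes \<mu> :: "(real^4) measure"
    and ip :: "real^4 \<Rightarrow> real^4 \<Rightarrow> real"
  assumes "haar_measure \<mu>"
    and "scalar_product_on engel_V1 ip"
  shows "\<exists>L\<ge>0. \<forall>X\<in>engel_V1. \<exists>w1 w2 w3 w4 :: real^4.
           distinct [w1, w2, w3, w4] \<and> independent {w1, w2, w3, w4} \<and>
           span {w1, w2, w3, w4} = UNIV \<and>
           (\<forall>E. constant_horizontal_normal \<mu> ip E X \<and>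
                \<not> vol_equivalent \<mu> E {} \<and> \<not> vol_equivalent \<mu> E UNIV \<longrightarrow>
              (\<exists>h :: real^3 \<Rightarrow> real. L-lipschitz_on UNIV h \<and>
                 vol_equivalent \<mu> E
                   {engel_Psi (a1 *\<^sub>R w1 + a2 *\<^sub>R w2 + a3 *\<^sub>R w3 + a4 *\<^sub>R w4) | a1 a2 a3 a4.
                      a4 > h (vector [a1, a2, a3])}))"
proof (rule exI[of _ 1], intro conjI ballI)
  \<comment> \<open>The constant 1 is the slope of \<open>future\<close>. The dependence on
    \<open>X\<close> and on the scalar product is absorbed by the two signs, hence by the
    basis.\<close>
  fix X assume X: "X \<in> engel_V1"
  obtain \<sigma> \<epsilon> :: real where signs: "\<sigma> = 1 \<or> \<sigma> = -1" "\<epsilon> = 1 \<or> \<epsilon> = -1"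
    and frame: "\<And>E. E \<in> sets borel \<Longrightarrow> X \<in> monotone_dirs E \<Longrightarrow>
      \<forall>Y\<in>engel_V1. ip X Y = 0 \<longrightarrow> Y \<in> monotone_dirs E \<and> - Y \<in> monotone_dirs E \<Longrightarrow>
      monotone_frame E \<sigma> \<epsilon>"
    by (rule constant_normal_frame[OF assms(2) X]) blast
  obtain w1 w2 w3 w4 where w: "frame_basis \<sigma> \<epsilon> = (w1, w2, w3, w4)"
    by (cases "frame_basis \<sigma> \<epsilon>") auto
  have H: "{engel_Psi (a1 *\<^sub>R w1 + a2 *\<^sub>R w2 + a3 *\<^sub>R w3 + a4 *\<^sub>R w4) | a1 a2 a3 a4. a4 > h (vector [a1, a2, a3])}
      = frame_coords \<sigma> \<epsilon> ` {z. snd z > h (fst z)}" for h :: "real^3 \<Rightarrow> real"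
  proof -
    have v: "vector [a $ 1, a $ 2, a $ 3] = a" for a :: "real^3"
      by (simp add: vec_eq_iff forall_3 vector_3)
    show ?thesis
    proof (intro equalityI subsetI)
      fix p assume "p \<in> {engel_Psi (a1 *\<^sub>R w1 + a2 *\<^sub>R w2 + a3 *\<^sub>R w3 + a4 *\<^sub>R w4) | a1 a2 a3 a4. a4 > h (vector [a1, a2, a3])}"
      then obtain a1 a2 a3 a4 where "p = engel_Psi (a1 *\<^sub>R w1 + a2 *\<^sub>R w2 + a3 *\<^sub>R w3 + a4 *\<^sub>R w4)"
        "a4 > h (vector [a1, a2, a3])" by blast
      then show "p \<in> frame_coords \<sigma> \<epsilon> ` {z. snd z > h (fst z)}"
        by (intro image_eqI[of _ _ "(vector [a1, a2, a3], a4)"])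
           (simp_all add: frame_coords_def frame_map_def w vector_3)
    next
      fix p assume "p \<in> frame_coords \<sigma> \<epsilon> ` {z. snd z > h (fst z)}"
      then obtain a b where ab: "b > h a" "p = engel_Psi (a$1 *\<^sub>R w1 + a$2 *\<^sub>R w2 + a$3 *\<^sub>R w3 + b *\<^sub>R w4)"
        by (auto simp: frame_coords_def frame_map_def w)
      then have "b > h (vector [a$1, a$2, a$3])" by (simp add: v)
      with ab(2) show "p \<in> {engel_Psi (a1 *\<^sub>R w1 + a2 *\<^sub>R w2 + a3 *\<^sub>R w3 + a4 *\<^sub>R w4) | a1 a2 a3 a4. a4 > h (vector [a1, a2, a3])}"
        by blast
    qed
  qed
  show "\<exists>w1 w2 w3 w4 :: real^4.
           distinct [w1, w2, w3, w4] \<and> independent {w1, w2, w3, w4} \<and>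
           span {w1, w2, w3, w4} = UNIV \<and>
           (\<forall>E. constant_horizontal_normal \<mu> ip E X \<and>
                \<not> vol_equivalent \<mu> E {} \<and> \<not> vol_equivalent \<mu> E UNIV \<longrightarrow>
              (\<exists>h :: real^3 \<Rightarrow> real. 1-lipschitz_on UNIV h \<and>
                 vol_equivalent \<mu> E
                   {engel_Psi (a1 *\<^sub>R w1 + a2 *\<^sub>R w2 + a3 *\<^sub>R w3 + a4 *\<^sub>R w4) | a1 a2 a3 a4.
                      a4 > h (vector [a1, a2, a3])}))"
  proof (rule exI[of _ w1], rule exI[of _ w2], rule exI[of _ w3], rule exI[of _ w4],
      intro conjI allI impI frame_basis_basis[OF w signs])
    fix E
    assume asm: "constant_horizontal_normal \<mu> ip E X \<and>
      \<not> vol_equivalent \<mu> E {} \<and> \<not> vol_equivalent \<mu> E UNIV"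

    then have Em: "E \<in> sets (completion \<mu>)" by (simp add: constant_horizontal_normal_def)
    obtain S where S: "S \<in> sets borel"
      "negligible (E - S \<union> (S - E))" "\<And>X. deriv_indicator_nonneg \<mu> X E \<Longrightarrow> X \<in> monotone_dirs S"
      "\<And>X. deriv_indicator_zero \<mu> X E \<Longrightarrow> X \<in> monotone_dirs S \<and> - X \<in> monotone_dirs S"
      by (rule haar_borel_representative[OF assms(1) Em]) blast
    have F: "monotone_frame S \<sigma> \<epsilon>"
      using asm S(3,4) by (intro frame S(1)) (auto simp: constant_horizontal_normal_def)
    have vol: "vol_equivalent \<mu> E T \<longleftrightarrow> negligible (S - T) \<and> negligible (T - S)" for T
    proof -
      have "negligible (E - T \<union> (T - E)) \<longleftrightarrow> negligible (S - T \<union> (T - S))"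
      proof
        assume "negligible (E - T \<union> (T - E))"
        from negligible_Un[OF this S(2)] show "negligible (S - T \<union> (T - S))"
          by (rule negligible_subset) blast
      next
        assume "negligible (S - T \<union> (T - S))"
        from negligible_Un[OF this S(2)] show "negligible (E - T \<union> (T - E))"
          by (rule negligible_subset) blast
      qed
      then show ?thesis
        by (simp add: vol_equivalent_iff_negligible[OF assms(1)] negligible_Un_eq)
    qed
    have "\<not> negligible S" "\<not> negligible (- S)"
      using asm by (simp_all add: vol Compl_eq_Diff_UNIV)
    from monotone_frame_epigraph[OF S(1) F signs this]
    obtain h where "1-lipschitz_on UNIV h"
      "negligible (S - frame_coords \<sigma> \<epsilon> ` {z. snd z > h (fst z)})"
      "negligible (frame_coords \<sigma> \<epsilon> ` {z. snd z > h (fst z)} - S)" .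
    then show "\<exists>h :: real^3 \<Rightarrow> real. 1-lipschitz_on UNIV h \<and>
        vol_equivalent \<mu> E {engel_Psi (a1 *\<^sub>R w1 + a2 *\<^sub>R w2 + a3 *\<^sub>R w3 + a4 *\<^sub>R w4) | a1 a2 a3 a4.
          a4 > h (vector [a1, a2, a3])}"
      unfolding H vol by blast
  qed
qed simp

end
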